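(* Let $A$ be a finite abelian group and let $p \geq 5$ be a prime. Then, as formal power series in $t$, $$Z_p(A;t) = \frac{\widehat{Z}_p(A;t)}{\displaystyle\prod_{a \in \mathrm{Frob}_p(A)}(1-at)}.$$
   Context: For $\alpha,\beta\in\mathbb{F}_p$ with $4\alpha^3-27\beta^2\neq 0$, let $E(\alpha,\beta)$ be the elliptic curve $y^2z=x^3-\alpha xz^2-\beta z^3$ over $\mathbb{F}_p$, let $N_E(p)$ be its number of $\mathbb{F}_p$-rational points (including the point at infinity), and let $$a_E(p) = p+1-N_E(p) = -\sum_{x\in\mathbb{F}_p}\left(\frac{x^3-\alpha x-\beta}{p}\right),$$ where $\left(\frac{\cdot}{p}\right)$ is the Legendre symbol. Write $A\hookrightarrow E(\alpha,\beta)$ if the group $E(\alpha,\beta)(\mathbb{F}_p)$ contains a subgroup isomorphic to $A$. For $m\ge 0$ the $m$th power moment is $$M_p(A;m) = \sum_{\substack{\alpha,\beta\in\mathbb{F}_p\\ 4\alpha^3-27\beta^2\neq0\\ A\hookrightarrow E(\alpha,\beta)}} a_{E(\alpha,\beta)}(p)^m$$ (with $0^0=1$, so $M_p(A;0)$ is the number of pairs $(\alpha,\beta)$ in the sum), and $Z_p(A;t)=\sum_{m=0}^\infty M_p(A;m)t^m$. Let $$\mathrm{Frob}_p(A)=\{a\in\mathbb{Z} : -2\sqrt p\le a\le 2\sqrt p,\ a\equiv p+1 \pmod{|A|}\},$$ $$\delta_A(p)=\#\{a\in\mathbb{Z}: 0<|a|\le 2\sqrt p,\ a\equiv p+1\pmod{|A|}\}.$$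 Define integers $c_p(A;n)$, $n\ge0$, by $$\sum_{n=0}^\infty c_p(A;n)t^n = \left(M_p(A;0)+M_p(A;1)t+\cdots+M_p(A;\delta_A(p))t^{\delta_A(p)}\right)\prod_{a\in\mathrm{Frob}_p(A)}(1-at),$$ and set $\widehat{Z}_p(A;t)=c_p(A;0)+c_p(A;1)t+\cdots+c_p(A;\delta_A(p))t^{\delta_A(p)}$. *)

theory Defs
  imports
    "HOL-Algebra.Coset"
    "HOL-Computational_Algebra.Formal_Power_Series"
    "HOL-Number_Theory.Cong"
    "Berlekamp_Zassenhaus.Finite_Field"
begin

section \<open>The elliptic curve \<open>y\<^sup>2 z = x\<^sup>3 - \<alpha> x z\<^sup>2 - \<beta> z\<^sup>3\<close>\<close>

text \<open>
  Points of the projective curve are given by the affine chart \<open>z = 1\<close> together with the single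
  point \<open>[0 : 1 : 0]\<close> on the line \<open>z = 0\<close>; see the two lemmas below.
\<close>

datatype 'a ell_point = Infinity | Affine 'a 'a

definition nonsingular :: "'a::field \<Rightarrow> 'a \<Rightarrow> bool" where
  "nonsingular \<alpha> \<beta> \<longleftrightarrow> 4 * \<alpha> ^ 3 - 27 * \<beta> ^ 2 \<noteq> 0"

fun on_curve :: "'a::field \<Rightarrow> 'a \<Rightarrow> 'a ell_point \<Rightarrow> bool" where
  "on_curve \<alpha> \<beta> Infinity \<longleftrightarrow> True"
| "on_curve \<alpha> \<beta> (Affine x y) \<longleftrightarrow> y ^ 2 = x ^ 3 - \<alpha> * x - \<beta>"

lemma projective_curve_at_infinity:
  fixes x y \<alpha> \<beta> :: "'a::field"
  shows "y ^ 2 * 0 = x ^ 3 - \<alpha> * x * 0 ^ 2 - \<beta> * 0 ^ 3 \<longleftrightarrow> x = 0"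
  by (simp add: zero_power)

lemma projective_curve_affine_chart:
  fixes x y z \<alpha> \<beta> :: "'a::field"
  assumes "z \<noteq> 0"
  shows "y ^ 2 * z = x ^ 3 - \<alpha> * x * z ^ 2 - \<beta> * z ^ 3 \<longleftrightarrow> on_curve \<alpha> \<beta> (Affine (x / z) (y / z))"
  using assms by (simp add: field_simps power2_eq_square power3_eq_cube)

text \<open>
  The chord-tangent law with neutral element \<open>Infinity\<close>.  For two points of the curve with the
  same abscissa that are not mutually inverse, the points coincide and have nonzero ordinate, so
  the slope is that of the tangent.
\<close>

fun ell_add :: "'a::field \<Rightarrow> 'a ell_point \<Rightarrow> 'a ell_point \<Rightarrow> 'a ell_point" where
  "ell_add \<alpha> Infinity Q = Q"
| "ell_add \<alpha> (Affine x1 y1) Infinity = Affine x1 y1"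
| "ell_add \<alpha> (Affine x1 y1) (Affine x2 y2) =
     (if x1 = x2 \<and> y1 = - y2 then Infinity
      else let l = (if x1 = x2 then (3 * x1 ^ 2 - \<alpha>) / (2 * y1) else (y2 - y1) / (x2 - x1));
               x3 = l ^ 2 - x1 - x2
           in Affine x3 (l * (x1 - x3) - y1))"

definition ell_group :: "'a::field \<Rightarrow> 'a \<Rightarrow> 'a ell_point monoid" where
  "ell_group \<alpha> \<beta> =
     \<lparr>carrier = {P. on_curve \<alpha> \<beta> P}, monoid.mult = ell_add \<alpha>, one = Infinity\<rparr>"

definition frob_trace :: "'a::{field,finite} \<Rightarrow> 'a \<Rightarrow> int" where
  "frob_trace \<alpha> \<beta> = int CARD('a) + 1 - int (card (carrier (ell_group \<alpha> \<beta>)))"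

definition embeds_in :: "('g, 'e) monoid_scheme \<Rightarrow> ('h, 'f) monoid_scheme \<Rightarrow> bool" where
  "embeds_in A G \<longleftrightarrow> (\<exists>H. subgroup H G \<and> A \<cong> G\<lparr>carrier := H\<rparr>)"


section \<open>Power moments over \<open>F\<^sub>p\<close>\<close>

text \<open>
  The field with \<open>p\<close> elements is \<open>'p mod_ring\<close>, where \<open>p = CARD('p)\<close>; the type
  \<open>'p\<close> is passed explicitly to the quantities that depend on curves over this field.
\<close>

definition power_moment ::
    "'p::prime_card itself \<Rightarrow> ('g, 'e) monoid_scheme \<Rightarrow> nat \<Rightarrow> int" where
  "power_moment _ A m =
     (\<Sum>(\<alpha>, \<beta>) \<in> {(\<alpha> :: 'p mod_ring, \<beta>). nonsingular \<alpha> \<beta> \<and> embeds_in A (ell_group \<alpha> \<beta>)}.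
        frob_trace \<alpha> \<beta> ^ m)"

definition Frob :: "nat \<Rightarrow> ('g, 'e) monoid_scheme \<Rightarrow> int set" where
  "Frob p A =
     {a. - 2 * sqrt (real p) \<le> real_of_int a \<and> real_of_int a \<le> 2 * sqrt (real p) \<and>
         [a = int p + 1] (mod int (Coset.order A))}"

definition delta :: "nat \<Rightarrow> ('g, 'e) monoid_scheme \<Rightarrow> nat" where
  "delta p A =
     card {a :: int. 0 < \<bar>a\<bar> \<and> real_of_int \<bar>a\<bar> \<le> 2 * sqrt (real p) \<and>
                     [a = int p + 1] (mod int (Coset.order A))}"

definition numer_coeff ::
    "'p::prime_card itself \<Rightarrow> ('g, 'e) monoid_scheme \<Rightarrow> nat \<Rightarrow> int" where
  "numer_coeff T A n =
     fps_nth ((\<Sum>m \<le> delta CARD('p) A. fps_const (power_moment T A m) * fps_X ^ m)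
              * (\<Prod>a \<in> Frob CARD('p) A. 1 - fps_const a * fps_X)) n"

text \<open>
  The coefficients of both series are integers; they are viewed in \<open>Q[[t]]\<close> because division of
  formal power series is available over a field.
\<close>

definition moment_series :: "'p::prime_card itself \<Rightarrow> ('g, 'e) monoid_scheme \<Rightarrow> rat fps" where
  "moment_series T A = Abs_fps (\<lambda>m. of_int (power_moment T A m))"

definition moment_numer :: "'p::prime_card itself \<Rightarrow> ('g, 'e) monoid_scheme \<Rightarrow> rat fps" where
  "moment_numer T A =
     (\<Sum>n \<le> delta CARD('p) A. fps_const (of_int (numer_coeff T A n)) * fps_X ^ n)"

end

(*
  Since 1 / (1 - a t) is the generating function of the powers of a, the moment series is
  a sum of terms 1 / (1 - a_E t), and multiplication by the product of the factors 1 - a t over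
  Frob gives a polynomial of degree at most delta, provided that every trace a_E lies in Frob.
  The congruence for a_E is Lagrange's theorem, which needs the associativity of the group law.
  The bound |a_E| <= 2 sqrt p is Hasse's theorem, proved by Manin's method: let f be the cubic,
  Q = (t, 1) and P = (t^p, f(t)^((p-1)/2)) on the curve f(t) y^2 = f(x) over F_p(t), and let d(n) be
  the degree of the numerator of the abscissa of P + n Q in lowest terms.  Then
  d(n - 1) + d(n + 1) = 2 d(n) + 2, d(0) = p and d(-1) = N_E, hence d(n) = n^2 + a_E n + p.
  As d(n) >= 0 for all integers n and p is odd, a_E^2 <= 4 p.
*)
theory Submission
  imports Defs
begin

section \<open>The group law\<close>

text \<open>The twist is used because its points over F_p(t) stand for maps of the curve to itself:
  if s^2 = f(t), the point (x, y) is the map (t, s) -> (x, s y). The generic point is the identity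
  and \<open>frob_point\<close> is Frobenius, so d(n) is the degree of Frobenius plus n, and d(-1) =
  N_E reflects that the kernel of Frobenius minus 1 is the group of rational points. The obstacle is
  cancellation. The abscissae of R + Q and R - Q are the roots of a quadratic equation with
  coefficients explicit in the abscissa of R, but d asks for lowest terms. Gauss's lemma excludes a
  common factor on one side of these formulas and the invertible discriminant on the other, so both
  sides agree up to a constant. Degrees of numerators then add up because the abscissae keep a pole
  at t = infinity; the neutral element fits in with degree 0. Over F_p(t) the argument rests on
  closure and on (P + Q) - Q = P; the full group law serves the curves over F_p.\<close>

fun ell_neg :: "'a::field ell_point \<Rightarrow> 'a ell_point" where
  "ell_neg Infinity = Infinity"
| "ell_neg (Affine x y) = Affine x (- y)"

lemma ell_neg_neg [simp]: "ell_neg (ell_neg P) = P"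
  by (cases P) auto

lemma on_curve_neg [simp]: "on_curve \<alpha> \<beta> (ell_neg P) \<longleftrightarrow> on_curve \<alpha> \<beta> P"
  by (cases P) auto

lemma ell_add_Infinity_right [simp]: "ell_add \<alpha> P Infinity = P"
  by (cases P) auto

text \<open>
  In the proof of associativity, \<open>l\<close>, \<open>m\<close>, \<open>n\<close>, \<open>k\<close> are the slopes in the additions
  \<open>P + Q\<close>, \<open>R + Q\<close>, \<open>(P + Q) + R\<close>, \<open>(R + Q) + P\<close>, and \<open>a\<close>, \<open>c\<close>, \<open>D\<close>, \<open>E\<close> are the abscissae of
  \<open>P\<close>, \<open>R\<close>, \<open>P + Q\<close>, \<open>R + Q\<close> relative to that of \<open>Q\<close>.
\<close>

lemma slopes_assoc:
  fixes a c D E e l m n k :: "'a::field"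
  assumes ne: "l \<noteq> m" and l: "l ^ 2 = a + D + e" and m: "m ^ 2 = c + E + e"
    and n: "n * (m - l) = c + D + e - m * l" and k: "k * (l - m) = a + E + e - l * m"
  shows "n ^ 2 - e - D - c = k ^ 2 - e - E - a"
    and "m * c + n * (n ^ 2 - e - D - c - c) = l * a + k * (n ^ 2 - e - D - c - a)"
proof -
  have ml: "m - l \<noteq> 0" using ne by simp
  have k': "k * (m - l) = l * m - a - E - e" using k by (simp add: algebra_simps)
  \<comment> \<open>The aim is n + l = k + m: the slopes of the two additions have the same sum for
    both bracketings. Both conclusions follow from this.\<close>
  have "(n - k) * (m - l) = n * (m - l) - k * (m - l)" by (simp add: algebra_simps)
  also have "\<dots> = l ^ 2 + m ^ 2 - 2 * l * m" unfolding n k' l m by (simp add: algebra_simps)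
  also have "\<dots> = (m - l) * (m - l)" by (simp add: power2_eq_square algebra_simps)
  finally have nk: "n - k = m - l" using ml by simp
  have "n ^ 2 - k ^ 2 = (n + k) * (n - k)" by (simp add: power2_eq_square algebra_simps)
  also have "\<dots> = n * (m - l) + k * (m - l)" unfolding nk by (simp add: algebra_simps)
  also have "\<dots> = D + c - E - a" unfolding n k' by (simp add: algebra_simps)
  finally show "n ^ 2 - e - D - c = k ^ 2 - e - E - a" by (simp add: algebra_simps)
  have "(m - l) * (n + l) = n * (m - l) + m * l - l ^ 2" by (simp add: power2_eq_square algebra_simps)
  also have "\<dots> = c - a" unfolding n l by simp
  finally have ca: "(m - l) * (n + l) = c - a" .
  have "n ^ 2 - e - D - c = n ^ 2 - n * (m - l) - m * l" unfolding n by simp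
  also have "\<dots> = (n - m) * (n + l)" by (simp add: power2_eq_square algebra_simps)
  finally have X: "n ^ 2 - e - D - c = (n - m) * (n + l)" .
  have "(n - k) * (n ^ 2 - e - D - c) = (n - m) * ((m - l) * (n + l))" unfolding X nk by simp
  also have "\<dots> = (n - m) * (c - a)" unfolding ca ..
  also have "\<dots> = n * c - m * c + l * a - (n - (m - l)) * a" by (simp add: algebra_simps)
  also have "n - (m - l) = k" using nk by (simp add: algebra_simps)
  finally show "m * c + n * (n ^ 2 - e - D - c - c) = l * a + k * (n ^ 2 - e - D - c - a)"
    by (simp add: algebra_simps)
qed

locale elliptic_curve =
  fixes \<alpha> \<beta> :: "'a::field"
  assumes two_neq_0: "(2::'a) \<noteq> 0" and nonsingular: "nonsingular \<alpha> \<beta>"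
begin

abbreviation add (infixl "+\<^sub>E" 65) where "P +\<^sub>E Q \<equiv> ell_add \<alpha> P Q"
abbreviation on where "on P \<equiv> on_curve \<alpha> \<beta> P"

lemma four_neq_0: "(4::'a) \<noteq> 0"
  using power_not_zero[OF two_neq_0, of 2] by simp

lemma uminus_eq_self_iff: "- y = y \<longleftrightarrow> y = 0" "y = - y \<longleftrightarrow> y = 0" for y :: 'a
  using two_neq_0 by (metis add.right_inverse mult_2 mult_eq_0_iff eq_neg_iff_add_eq_0 add_0)+

text \<open>A common zero of the cubic and its derivative makes the discriminant vanish. So the
  tangent at a point of order two is vertical, and the roots of the cubic are simple.\<close>

lemma order_two_not_critical:
  assumes "0 = x ^ 3 - \<alpha> * x - \<beta>"
  shows "3 * x ^ 2 - \<alpha> \<noteq> 0"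
proof
  assume "3 * x ^ 2 - \<alpha> = 0"
  then have a: "\<alpha> = 3 * x ^ 2" by simp
  then have b: "\<beta> = - 2 * x ^ 3" using assms by (simp add: power3_eq_cube power2_eq_square algebra_simps)
  have "4 * \<alpha> ^ 3 - 27 * \<beta> ^ 2 = 0" unfolding a b
    by (simp add: power_mult_distrib flip: power_mult)
  then show False using nonsingular by (simp add: nonsingular_def)
qed

lemma add_chord:
  "x1 \<noteq> x2 \<Longrightarrow> Affine x1 y1 +\<^sub>E Affine x2 y2 =
     Affine (((y2 - y1) / (x2 - x1)) ^ 2 - x1 - x2)
       ((y2 - y1) / (x2 - x1) * (x1 - (((y2 - y1) / (x2 - x1)) ^ 2 - x1 - x2)) - y1)"
  by (simp add: Let_def)

lemma add_tangent:
  "y \<noteq> 0 \<Longrightarrow> Affine x y +\<^sub>E Affine x y =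
     Affine (((3 * x ^ 2 - \<alpha>) / (2 * y)) ^ 2 - x - x)
       ((3 * x ^ 2 - \<alpha>) / (2 * y) * (x - (((3 * x ^ 2 - \<alpha>) / (2 * y)) ^ 2 - x - x)) - y)"
  by (simp add: Let_def uminus_eq_self_iff)

lemma add_opposite [simp]:
  "Affine x y +\<^sub>E Affine x (- y) = Infinity" "Affine x (- y) +\<^sub>E Affine x y = Infinity"
  by simp_all

declare ell_add.simps(3) [simp del]

lemma add_neg_self [simp]: "P +\<^sub>E ell_neg P = Infinity" "ell_neg P +\<^sub>E P = Infinity"
  by (cases P; simp)+

lemma same_abscissa:
  assumes "on (Affine x y)" "on (Affine x y')"
  shows "y' = y \<or> y' = - y"
  using assms by (simp, metis power2_eq_iff)

lemma point_pair_cases [consumes 2, case_names Infinity1 Infinity2 opposite tangent chord]: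
  assumes "on P" "on Q"
  obtains "P = Infinity" | "Q = Infinity" | "Q = ell_neg P"
  | x y where "P = Affine x y" "Q = Affine x y" "y \<noteq> 0"
  | x1 y1 x2 y2 where "P = Affine x1 y1" "Q = Affine x2 y2" "x1 \<noteq> x2"
proof (cases P; cases Q)
  fix x1 y1 x2 y2 assume PQ: "P = Affine x1 y1" "Q = Affine x2 y2"
  show ?thesis
  proof (cases "x1 = x2")
    case True
    then have "y2 = y1 \<or> y2 = - y1" using assms PQ same_abscissa by blast
    then show ?thesis
      using True PQ that(3,4) by (cases "y1 = 0") auto
  next
    case False then show ?thesis using that(5) PQ by blast
  qed
qed (use that in auto)

lemma add_comm:
  assumes "on P" "on Q"
  shows "P +\<^sub>E Q = Q +\<^sub>E P"
  using assms
proof (cases rule: point_pair_cases)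
  case (chord x1 y1 x2 y2)
  have "x1 - x2 \<noteq> 0" "x2 - x1 \<noteq> 0" using chord(3) by auto
  then have l: "(y2 - y1) / (x2 - x1) = (y1 - y2) / (x1 - x2)"
    by (simp add: frac_eq_eq) (simp add: algebra_simps)
  have c: "(y1 - y2) / (x1 - x2) * (x1 - x2) = y1 - y2" using chord(3) by simp
  define l where "l = (y1 - y2) / (x1 - x2)"
  show ?thesis
    using c unfolding chord add_chord[OF chord(3)] add_chord[OF chord(3)[symmetric]] l
    unfolding l_def[symmetric] by (simp add: algebra_simps)
qed auto

lemma neg_add: "ell_neg (P +\<^sub>E Q) = ell_neg P +\<^sub>E ell_neg Q" if "on P" "on Q"
  using that
proof (cases rule: point_pair_cases)
  case (tangent x y)
  have y: "- y \<noteq> 0" using tangent(3) by simp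
  show ?thesis
    unfolding tangent(1,2) add_tangent[OF tangent(3)] ell_neg.simps add_tangent[OF y]
    by simp
next
  case (chord x1 y1 x2 y2)
  have l: "(- y2 - - y1) / (x2 - x1) = - ((y2 - y1) / (x2 - x1))"
    by (simp add: minus_divide_left)
  show ?thesis
    unfolding chord(1,2) add_chord[OF chord(3)] ell_neg.simps l by simp
qed auto

text \<open>
  Chords and tangents are treated alike: the line through \<open>Q\<close> with slope \<open>l\<close> meets the curve in the
  points with abscissae \<open>x2\<close>, \<open>x1\<close> and \<open>x2 + D\<close>, and the last two equations are Vieta's formulas.
\<close>

lemma add_slope:
  assumes P: "on (Affine x1 y1)" and Q: "on (Affine x2 y2)" and opp: "\<not> (x1 = x2 \<and> y1 = - y2)"
  obtains l D where "Affine x1 y1 +\<^sub>E Affine x2 y2 = Affine (x2 + D) (- (y2 + l * D))"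
    "y1 = y2 + l * (x1 - x2)" "l ^ 2 = (x1 - x2) + D + 3 * x2"
    "(x1 - x2) * D = 3 * x2 ^ 2 - \<alpha> - 2 * l * y2"
proof (cases "x1 = x2")
  case True
  with opp same_abscissa[of x1 y1 y2] P Q have y: "y1 = y2" "y2 \<noteq> 0" by auto
  define l where "l = (3 * x2 ^ 2 - \<alpha>) / (2 * y2)"
  have "2 * y2 \<noteq> 0" using y two_neq_0 by simp
  then have l: "l * (2 * y2) = 3 * x2 ^ 2 - \<alpha>" by (simp add: l_def del: mult_eq_0_iff)
  have "Affine x1 y1 +\<^sub>E Affine x2 y2 = Affine (x2 + (l ^ 2 - 3 * x2)) (- (y2 + l * (l ^ 2 - 3 * x2)))"
    unfolding True y(1) add_tangent[OF y(2)] l_def[symmetric] by (simp add: algebra_simps)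
  then show ?thesis
    by (rule that) (use y True l in \<open>simp_all add: algebra_simps\<close>)
next
  case False
  then have ne: "x1 - x2 \<noteq> 0" "x2 - x1 \<noteq> 0" by auto
  define l where "l = (y2 - y1) / (x2 - x1)"
  have "y2 - y1 = l * (x2 - x1)" using ne by (simp add: l_def)
  then have y1: "y1 = y2 + l * (x1 - x2)" by (simp add: algebra_simps)
  have e: "y2 ^ 2 = x2 ^ 3 - \<alpha> * x2 - \<beta>" "y1 ^ 2 = x1 ^ 3 - \<alpha> * x1 - \<beta>" using P Q by simp_all
  have "(x1 - x2) * (l * (2 * y2 + l * (x1 - x2))) = y1 ^ 2 - y2 ^ 2"
    unfolding y1 by (simp add: power2_eq_square algebra_simps)
  also have "\<dots> = (x1 - x2) * ((x1 - x2) ^ 2 + 3 * x2 * (x1 - x2) + 3 * x2 ^ 2 - \<alpha>)"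
    unfolding e by (simp add: power2_eq_square power3_eq_cube algebra_simps)
  finally have "l * (2 * y2 + l * (x1 - x2)) = (x1 - x2) ^ 2 + 3 * x2 * (x1 - x2) + 3 * x2 ^ 2 - \<alpha>"
    using ne by simp
  then have D: "(x1 - x2) * (l ^ 2 - (x1 - x2) - 3 * x2) = 3 * x2 ^ 2 - \<alpha> - 2 * l * y2"
    by (simp add: power2_eq_square algebra_simps)
  have "Affine x1 y1 +\<^sub>E Affine x2 y2 =
      Affine (x2 + (l ^ 2 - (x1 - x2) - 3 * x2)) (- (y2 + l * (l ^ 2 - (x1 - x2) - 3 * x2)))"
    using y1 unfolding add_chord[OF False] l_def[symmetric] by (simp add: algebra_simps)
  then show ?thesis by (rule that[OF _ y1 _ D]) simp
qed

section \<open>Closure, cancellation and associativity\<close>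

lemma add_closed:
  assumes "on P" "on Q"
  shows "on (P +\<^sub>E Q)"
proof -
  have "on (Affine x1 y1 +\<^sub>E Affine x2 y2)"
    if P: "on (Affine x1 y1)" and Q: "on (Affine x2 y2)" and opp: "\<not> (x1 = x2 \<and> y1 = - y2)" for x1 y1 x2 y2
  proof -
    obtain l D where add: "Affine x1 y1 +\<^sub>E Affine x2 y2 = Affine (x2 + D) (- (y2 + l * D))"
      and l: "l ^ 2 = (x1 - x2) + D + 3 * x2" "(x1 - x2) * D = 3 * x2 ^ 2 - \<alpha> - 2 * l * y2"
      using add_slope[OF P Q opp] by metis
    have "(- (y2 + l * D)) ^ 2 = y2 ^ 2 + 2 * l * y2 * D + l ^ 2 * D ^ 2"
      by (simp add: power2_eq_square algebra_simps)
    also have "\<dots> = y2 ^ 2 + (2 * l * y2 + (x1 - x2) * D) * D + D ^ 3 + 3 * x2 * D ^ 2"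
      unfolding l(1) by (simp add: power2_eq_square power3_eq_cube algebra_simps)
    also have "2 * l * y2 + (x1 - x2) * D = 3 * x2 ^ 2 - \<alpha>" unfolding l(2) by simp
    also have "y2 ^ 2 = x2 ^ 3 - \<alpha> * x2 - \<beta>" using Q by simp
    finally show ?thesis
      unfolding add by (simp add: power2_eq_square power3_eq_cube algebra_simps)
  qed
  then show ?thesis
    using assms by (cases "P = Infinity \<or> Q = Infinity \<or> P = ell_neg Q"; cases P; cases Q)
      (auto simp del: on_curve.simps(2))
qed

text \<open>The line through P, Q and -(P + Q), reflected, passes through -P, -Q and P + Q with
  slope \<open>- l\<close>; its third point with respect to P + Q and -Q is therefore -P. The
  degenerate cases of \<open>add_assoc\<close> reduce to this instance.\<close>

lemma add_neg_cancel:
  assumes P: "on P" and Q: "on Q"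
  shows "P +\<^sub>E Q +\<^sub>E ell_neg Q = P"
proof -
  consider "P = Infinity \<or> Q = Infinity" | "P = ell_neg Q"
    | (affine) x1 y1 x2 y2 where "P = Affine x1 y1" "Q = Affine x2 y2" "\<not> (x1 = x2 \<and> y1 = - y2)"
    by (cases P; cases Q) auto
  then show ?thesis
  proof cases
    case affine
    obtain l D where 1: "P +\<^sub>E Q = Affine (x2 + D) (- (y2 + l * D))"
      "y1 = y2 + l * (x1 - x2)" "l ^ 2 = (x1 - x2) + D + 3 * x2"
      "(x1 - x2) * D = 3 * x2 ^ 2 - \<alpha> - 2 * l * y2"
      using add_slope[of x1 y1 x2 y2] P Q affine by metis
    \<comment> \<open>For \<open>D = 0\<close> the line touches the curve at Q, and
      \<open>l' = - l\<close> has to come from the tangent condition, by cancelling 2 y2.\<close>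
    have y2: "y2 \<noteq> 0" if "D = 0"
      using 1(4) that order_two_not_critical[of x2] Q affine(2) by auto
    have onS: "on (Affine (x2 + D) (- (y2 + l * D)))" using add_closed[OF P Q] 1(1) by simp
    have onQ: "on (Affine x2 (- y2))" using Q affine(2) by simp
    have opp: "\<not> (x2 + D = x2 \<and> - (y2 + l * D) = - (- y2))"
      using y2 two_neq_0 by (auto simp: uminus_eq_self_iff)
    obtain l' D' where 2: "Affine (x2 + D) (- (y2 + l * D)) +\<^sub>E Affine x2 (- y2) = Affine (x2 + D') (- (- y2 + l' * D'))"
      "- (y2 + l * D) = - y2 + l' * (x2 + D - x2)" "l' ^ 2 = (x2 + D - x2) + D' + 3 * x2"
      "(x2 + D - x2) * D' = 3 * x2 ^ 2 - \<alpha> - 2 * l' * (- y2)"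
      using add_slope[OF onS onQ opp] by metis
    have "l' = - l"
    proof (cases "D = 0")
      case True
      have "2 * y2 * (l' + l) = 0" using 1(4) 2(4) True by (simp add: algebra_simps)
      then have "l' + l = 0" using y2[OF True] two_neq_0 by simp
      then show ?thesis by (simp add: eq_neg_iff_add_eq_0)
    next
      case False
      have "l' * D = - (l * D)" using 2(2) by simp
      then have "(l' + l) * D = 0" by (simp add: distrib_right)
      then have "l' + l = 0" using False by simp
      then show ?thesis by (simp add: eq_neg_iff_add_eq_0)
    qed
    moreover from this have "D' = x1 - x2" using 1(3) 2(3) by simp
    ultimately show ?thesis using 1(1,2) 2(1) affine(1,2) by simp
  qed auto
qed

text \<open>Eliminates the ordinates from the slope of (P + Q) + R and so supplies a hypothesis of
  \<open>slopes_assoc\<close>, with 3 x2 for \<open>e\<close>; exchanging P and R supplies the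
  other. \<open>opp\<close> says that P + Q is not -R.\<close>

lemma outer_slope:
  fixes x1 y1 x2 y2 x3 y3 l m n D E F :: 'a
  defines "a \<equiv> x1 - x2" and "c \<equiv> x3 - x2"
  assumes ne: "l \<noteq> m"
    and l: "l ^ 2 = a + D + 3 * x2" "a * D = 3 * x2 ^ 2 - \<alpha> - 2 * l * y2"
    and m: "m ^ 2 = c + E + 3 * x2" "c * E = 3 * x2 ^ 2 - \<alpha> - 2 * m * y2" "y3 = y2 + m * c"
    and n: "- (y2 + l * D) = y3 + n * (D - c)" "(D - c) * F = 3 * x3 ^ 2 - \<alpha> - 2 * n * y3"
    and opp: "\<not> (D = c \<and> y2 + l * D = y3)"
  shows "n * (m - l) = c + D + 3 * x2 - m * l"
proof (cases "D = c")
  case False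
  have "2 * y2 * (m - l) = a * D - c * E" unfolding l m by (simp add: algebra_simps)
  then have "(2 * y2 + m * c + l * D) * (m - l) = a * D - c * E + m ^ 2 * c - l ^ 2 * D + m * l * (D - c)"
    by (simp add: power2_eq_square algebra_simps)
  also have "\<dots> = (c + D + 3 * x2 - m * l) * (c - D)"
    unfolding l(1) m(1) by (simp add: algebra_simps)
  also have "2 * y2 + m * c + l * D = n * (c - D)"
    using n(1) m(3) by (simp add: algebra_simps)
  finally show ?thesis using False by simp
next
  case True
  \<comment> \<open>Here P + Q = R and \<open>n\<close> is the slope of the tangent at R. Both 2 y2
    and 2 y3 are multiples of \<open>c\<close>, which then cancels from the tangent
    condition.\<close>
  have "y3 = - (y2 + l * c)" using n(1) True by simp
  then have "2 * y2 + (m + l) * c = 0" using m(3) by (simp add: algebra_simps)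
  then have y2: "2 * y2 = - ((m + l) * c)" by (simp add: eq_neg_iff_add_eq_0)
  have "2 * y3 = 2 * y2 + 2 * m * c" using m(3) by (simp add: algebra_simps)
  then have y3: "2 * y3 = (m - l) * c" unfolding y2 by (simp add: algebra_simps)
  have c: "c \<noteq> 0"
  proof
    assume "c = 0"
    then have "y2 = 0" "y3 = 0" using y2 y3 two_neq_0 by simp_all
    then show False using opp True \<open>c = 0\<close> by simp
  qed
  have "n * (m - l) * c = 3 * x3 ^ 2 - \<alpha>" using n(2) y3 True by (simp add: mult.assoc mult.left_commute)
  also have "x3 = x2 + c" by (simp add: c_def)
  also have "3 * (x2 + c) ^ 2 - \<alpha> = (3 * c + 6 * x2) * c + (3 * x2 ^ 2 - \<alpha>)"
    by (simp add: power2_eq_square algebra_simps)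
  also have "3 * x2 ^ 2 - \<alpha> = a * c + l * (2 * y2)" using l(2) True by (simp add: algebra_simps)
  also have "(3 * c + 6 * x2) * c + (a * c + l * (2 * y2)) = (3 * c + 6 * x2 + a - l ^ 2 - m * l) * c"
    unfolding y2 by (simp add: power2_eq_square algebra_simps)
  finally have "n * (m - l) = 3 * c + 6 * x2 + a - l ^ 2 - m * l" using c by simp
  then show ?thesis unfolding l(1) True by simp
qed

text \<open>With (R + Q) + P in place of P + (Q + R) the two sides are exchanged by swapping P and
  R, so one slope formula serves both. Equal points P and R would give equal inner slopes, whereas
  the formulas divide by \<open>m - l\<close>.\<close>

lemma add_assoc_nondegenerate:
  assumes P: "on P" and Q: "on Q" and R: "on R"
    and inf: "P \<noteq> Infinity" "Q \<noteq> Infinity" "R \<noteq> Infinity"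
    and PQ: "Q \<noteq> ell_neg P" and QR: "R \<noteq> ell_neg Q"
    and PQ_R: "R \<noteq> ell_neg (P +\<^sub>E Q)" and P_QR: "Q +\<^sub>E R \<noteq> ell_neg P"
    and "P \<noteq> R"
  shows "P +\<^sub>E Q +\<^sub>E R = R +\<^sub>E Q +\<^sub>E P"
proof -
  obtain x1 y1 x2 y2 x3 y3 where aff: "P = Affine x1 y1" "Q = Affine x2 y2" "R = Affine x3 y3"
    using inf by (metis ell_point.exhaust)
  define a c where "a = x1 - x2" and "c = x3 - x2"
  have opp: "\<not> (x1 = x2 \<and> y1 = - y2)" "\<not> (x3 = x2 \<and> y3 = - y2)"
    using PQ QR aff by auto
  obtain l D where 1: "P +\<^sub>E Q = Affine (x2 + D) (- (y2 + l * D))" "y1 = y2 + l * a"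
    "l ^ 2 = a + D + 3 * x2" "a * D = 3 * x2 ^ 2 - \<alpha> - 2 * l * y2"
    using add_slope[OF _ _ opp(1)] P Q unfolding aff a_def by metis
  obtain m E where 2: "R +\<^sub>E Q = Affine (x2 + E) (- (y2 + m * E))" "y3 = y2 + m * c"
    "m ^ 2 = c + E + 3 * x2" "c * E = 3 * x2 ^ 2 - \<alpha> - 2 * m * y2"
    using add_slope[OF _ _ opp(2)] R Q unfolding aff c_def by metis
  have on: "on (Affine (x2 + D) (- (y2 + l * D)))" "on (Affine (x2 + E) (- (y2 + m * E)))"
    using add_closed P Q R 1(1) 2(1) by metis+
  have opp': "\<not> (x2 + D = x3 \<and> - (y2 + l * D) = - y3)" "\<not> (x2 + E = x1 \<and> - (y2 + m * E) = - y1)"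
    using PQ_R P_QR add_comm[OF Q R] 1(1) 2(1) aff by (metis ell_neg.simps(2) minus_minus)+
  have D_c: "D - c = x2 + D - x3" and E_a: "E - a = x2 + E - x1" by (simp_all add: a_def c_def)
  obtain n F where 3: "P +\<^sub>E Q +\<^sub>E R = Affine (x3 + F) (- (y3 + n * F))"
    "- (y2 + l * D) = y3 + n * (D - c)" "n ^ 2 = (D - c) + F + 3 * x3"
    "(D - c) * F = 3 * x3 ^ 2 - \<alpha> - 2 * n * y3"
    using add_slope[OF on(1) _ opp'(1)] R unfolding 1(1) unfolding aff(3) D_c by metis
  obtain k G where 4: "R +\<^sub>E Q +\<^sub>E P = Affine (x1 + G) (- (y1 + k * G))"
    "- (y2 + m * E) = y1 + k * (E - a)" "k ^ 2 = (E - a) + G + 3 * x1"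
    "(E - a) * G = 3 * x1 ^ 2 - \<alpha> - 2 * k * y1"
    using add_slope[OF on(2) _ opp'(2)] P unfolding 2(1) unfolding aff(1) E_a by metis
  \<comment> \<open>If \<open>l = m\<close>, then R lies on the line through P and Q, which meets
    the curve outside Q in P and -(P + Q); R is neither of them.\<close>
  have ne: "l \<noteq> m"
  proof
    assume "l = m"
    then have "a + D = c + E" "a * D = c * E" using 1 2 by simp_all
    moreover have "(c - a) * (c - D) = c * (c - (a + D)) + a * D" by (simp add: algebra_simps)
    ultimately have "(c - a) * (c - D) = 0" by (simp add: algebra_simps)
    then consider "c = a" | "c = D" by auto
    then show False
    proof cases
      case 1
      then have "x3 = x1" "y3 = y1" using \<open>l = m\<close> \<open>y1 = _\<close> \<open>y3 = _\<close> by (simp_all add: a_def c_def)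
      then show False using \<open>P \<noteq> R\<close> aff by simp
    next
      case 2
      then have "x3 = x2 + D" by (simp add: c_def algebra_simps)
      moreover have "y3 = y2 + l * D" using 2 \<open>l = m\<close> \<open>y3 = _\<close> by simp
      ultimately show False using opp'(1) by simp
    qed
  qed
  have "\<not> (D = c \<and> y2 + l * D = y3)" "\<not> (E = a \<and> y2 + m * E = y1)"
    using opp' by (auto simp: a_def c_def)
  note opp'' = this[unfolded a_def c_def]
  have n: "n * (m - l) = c + D + 3 * x2 - m * l"
    using outer_slope[OF ne, of x1 x2 D y2 x3 E y3 n F] 1(3,4) 2(2,3,4) 3(2,4) opp''(1)
    unfolding a_def c_def by blast
  have k: "k * (l - m) = a + E + 3 * x2 - l * m"
    using outer_slope[OF ne[symmetric], of x3 x2 E y2 x1 D y1 k G] 2(3,4) 1(2,3,4) 4(2,4) opp''(2)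
    unfolding a_def c_def by blast
  note assoc = slopes_assoc[OF ne 1(3) 2(3) n k]
  have F: "F = n ^ 2 - 3 * x2 - D - c - c" using 3(3) by (simp add: c_def algebra_simps)
  have G: "G = k ^ 2 - 3 * x2 - E - a - a" using 4(3) by (simp add: a_def algebra_simps)
  have "x3 + F = x2 + (n ^ 2 - 3 * x2 - D - c)" by (simp add: F c_def algebra_simps)
  also have "\<dots> = x1 + G" unfolding assoc(1) by (simp add: G a_def algebra_simps)
  finally have "x3 + F = x1 + G" .
  moreover have "y3 + n * F = y1 + k * G"
    using assoc(2) unfolding 1(2) 2(2) F G assoc(1)[symmetric] by simp
  ultimately show ?thesis using 3(1) 4(1) by simp
qed

lemma add_assoc:
  assumes P: "on P" and Q: "on Q" and R: "on R"
  shows "P +\<^sub>E Q +\<^sub>E R = P +\<^sub>E (Q +\<^sub>E R)"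
proof -
  note on = P Q R add_closed[OF P Q] add_closed[OF Q R] add_closed[OF R Q] add_closed[OF Q P]
  consider "P = Infinity \<or> Q = Infinity \<or> R = Infinity" | "Q = ell_neg P" | "R = ell_neg Q"
    | "R = ell_neg (P +\<^sub>E Q)" | "Q +\<^sub>E R = ell_neg P"
    | (nondegenerate) "P \<noteq> Infinity" "Q \<noteq> Infinity" "R \<noteq> Infinity" "Q \<noteq> ell_neg P" "R \<noteq> ell_neg Q"
        "R \<noteq> ell_neg (P +\<^sub>E Q)" "Q +\<^sub>E R \<noteq> ell_neg P"
    by blast
  then show ?thesis
  proof cases
    case 1 then show ?thesis by auto
  next
    case 2
    have "P +\<^sub>E (Q +\<^sub>E R) = R +\<^sub>E Q +\<^sub>E P"
      using on by (metis add_comm)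
    then show ?thesis using add_neg_cancel[OF R Q] 2 by simp
  next
    case 3 then show ?thesis using add_neg_cancel[OF P Q] by simp
  next
    case 4
    have "Q +\<^sub>E R = ell_neg P +\<^sub>E ell_neg Q +\<^sub>E ell_neg (ell_neg Q)"
      using on 4 neg_add[OF P Q] by (metis add_comm ell_neg_neg on_curve_neg)
    then show ?thesis using add_neg_cancel[of "ell_neg P" "ell_neg Q"] 4 on by simp
  next
    case 5
    have "R = ell_neg P +\<^sub>E ell_neg Q"
      using add_neg_cancel[OF R Q] 5 on by (metis add_comm)
    then have "R = ell_neg (P +\<^sub>E Q)" using neg_add[OF P Q] by simp
    then show ?thesis using 5 by simp
  next
    case nondegenerate
    have rev: "P +\<^sub>E (Q +\<^sub>E R) = R +\<^sub>E Q +\<^sub>E P" using on by (metis add_comm)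
    show ?thesis
    proof (cases "P = R")
      case True then show ?thesis using rev by simp
    next
      case False then show ?thesis
        using add_assoc_nondegenerate[OF P Q R] nondegenerate rev by simp
    qed
  qed
qed

lemma group_ell_group: "group (ell_group \<alpha> \<beta>)"
proof (rule groupI)
  fix P assume "P \<in> carrier (ell_group \<alpha> \<beta>)"
  then show "\<exists>Q\<in>carrier (ell_group \<alpha> \<beta>). Q \<otimes>\<^bsub>ell_group \<alpha> \<beta>\<^esub> P = \<one>\<^bsub>ell_group \<alpha> \<beta>\<^esub>"
    by (intro bexI[of _ "ell_neg P"]) (simp_all add: ell_group_def)
qed (simp_all add: ell_group_def add_closed add_assoc)

end

section \<open>Lagrange's theorem for embedded groups\<close>

lemma embeds_in_dvd:
  assumes A: "group A" and G: "group G" and "finite (carrier G)" and "embeds_in A G"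
  shows "Coset.order A dvd Coset.order G"
proof -
  obtain H h where H: "subgroup H G" and h: "h \<in> iso A (G\<lparr>carrier := H\<rparr>)"
    using assms(4) by (auto simp: embeds_in_def is_iso_def)
  have "card (rcosets\<^bsub>G\<^esub> H) * card H = Coset.order G"
    using group.lagrange_finite[OF G assms(3) H] .
  moreover have "card H = Coset.order A"
    using h bij_betw_same_card[of h "carrier A" H] by (simp add: iso_def Coset.order_def)
  ultimately show ?thesis by (metis dvd_triv_right)
qed


section \<open>Abscissae of sums and differences\<close>

text \<open>\<open>(X : Z)\<close> are homogeneous coordinates of the abscissa of \<open>P\<close>, with \<open>(1 : 0)\<close> for \<open>Infinity\<close>.\<close>

definition abscissa :: "'a::field ell_point \<Rightarrow> 'a \<Rightarrow> 'a \<Rightarrow> bool" where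
  "abscissa P X Z \<longleftrightarrow> (case P of Infinity \<Rightarrow> X \<noteq> 0 \<and> Z = 0 | Affine x y \<Rightarrow> Z \<noteq> 0 \<and> X = x * Z)"

context elliptic_curve begin

text \<open>Changing the sign of \<open>s\<close> exchanges \<open>u\<close> and \<open>u'\<close>,
  so their symmetric functions involve \<open>y\<close> and \<open>s\<close> only through y^2 and
  s^2, which the curve equation eliminates.\<close>

lemma chord_sum_product:
  assumes P: "on (Affine x y)" and Q: "on (Affine t s)" and ne: "x \<noteq> t"
    and add: "Affine x y +\<^sub>E Affine t s = Affine u v"
    and sub: "Affine x y +\<^sub>E Affine t (- s) = Affine u' v'"
  shows "(x - t) ^ 2 * (u + u') = 2 * ((x + t) * (x * t - \<alpha>) - 2 * \<beta>)"
    and "(x - t) ^ 2 * (u * u') = (x * t + \<alpha>) ^ 2 + 4 * \<beta> * (x + t)"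
proof -
  have e: "y ^ 2 = x ^ 3 - \<alpha> * x - \<beta>" "s ^ 2 = t ^ 3 - \<alpha> * t - \<beta>" using P Q by simp_all
  have d: "t - x \<noteq> 0" using ne by simp
  define l l' where "l = (s - y) / (t - x)" and "l' = (- s - y) / (t - x)"
  have u: "u = l ^ 2 - (x + t)" "u' = l' ^ 2 - (x + t)"
    using add sub ne by (auto simp: add_chord l_def l'_def)
  have l: "l * (t - x) = s - y" "l' * (t - x) = - s - y" using d by (simp_all add: l_def l'_def)
  have sum: "(x - t) ^ 2 * (l ^ 2 + l' ^ 2) = 2 * (y ^ 2 + s ^ 2)"
  proof -
    have "(x - t) ^ 2 * (l ^ 2 + l' ^ 2) = (l * (t - x)) ^ 2 + (l' * (t - x)) ^ 2"
      by (simp add: power2_eq_square algebra_simps)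
    then show ?thesis unfolding l by (simp add: power2_eq_square algebra_simps)
  qed
  have prod: "(t - x) * (l * l') = - (x ^ 2 + x * t + t ^ 2 - \<alpha>)"
  proof -
    have "(t - x) * ((t - x) * (l * l')) = (l * (t - x)) * (l' * (t - x))" by (simp add: algebra_simps)
    also have "\<dots> = y ^ 2 - s ^ 2" unfolding l by (simp add: power2_eq_square algebra_simps)
    also have "\<dots> = (t - x) * - (x ^ 2 + x * t + t ^ 2 - \<alpha>)"
      unfolding e by (simp add: power2_eq_square power3_eq_cube algebra_simps)
    finally show ?thesis using d by simp
  qed
  have "(x - t) ^ 2 * (u + u') = (x - t) ^ 2 * (l ^ 2 + l' ^ 2) - 2 * (x + t) * (x - t) ^ 2"
    unfolding u by (simp add: algebra_simps)
  then show "(x - t) ^ 2 * (u + u') = 2 * ((x + t) * (x * t - \<alpha>) - 2 * \<beta>)"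
    unfolding sum e by (simp add: power2_eq_square power3_eq_cube algebra_simps)
  have "(x - t) ^ 2 * (u * u') = ((t - x) * (l * l')) ^ 2 - (x + t) * ((x - t) ^ 2 * (l ^ 2 + l' ^ 2))
      + (x + t) ^ 2 * (x - t) ^ 2"
    unfolding u by (simp add: power2_eq_square algebra_simps)
  then show "(x - t) ^ 2 * (u * u') = (x * t + \<alpha>) ^ 2 + 4 * \<beta> * (x + t)"
    unfolding sum prod e by (simp add: power2_eq_square power3_eq_cube algebra_simps)
qed

lemma tangent_abscissa:
  assumes P: "on (Affine t s)" and s: "s \<noteq> 0" and dbl: "Affine t s +\<^sub>E Affine t s = Affine u v"
  shows "4 * (t ^ 3 - \<alpha> * t - \<beta>) * u = (t ^ 2 + \<alpha>) ^ 2 + 8 * \<beta> * t"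
proof -
  have e: "s ^ 2 = t ^ 3 - \<alpha> * t - \<beta>" using P by simp
  define l where "l = (3 * t ^ 2 - \<alpha>) / (2 * s)"
  have "2 * s \<noteq> 0" using s two_neq_0 by simp
  then have l: "l * (2 * s) = 3 * t ^ 2 - \<alpha>" by (simp add: l_def del: mult_eq_0_iff)
  have u: "u = l ^ 2 - 2 * t" using dbl s by (auto simp: add_tangent l_def)
  have "4 * s ^ 2 * u = (l * (2 * s)) ^ 2 - 8 * t * s ^ 2"
    unfolding u by (simp add: power2_eq_square algebra_simps)
  then show ?thesis
    unfolding l e by (simp add: power2_eq_square power3_eq_cube algebra_simps)
qed

text \<open>
  In homogeneous coordinates the symmetric functions of the abscissae of \<open>P + Q\<close> and \<open>P - Q\<close> are
  given by the same formulas in all cases, including \<open>P = \<plusminus>Q\<close> and \<open>P = Infinity\<close>.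
\<close>

lemma abscissa_add_sub:
  assumes P: "on P" and Q: "on (Affine t s)" and s: "s \<noteq> 0"
    and X: "abscissa P X Z"
    and X1: "abscissa (P +\<^sub>E Affine t s) X1 Z1" and X2: "abscissa (P +\<^sub>E Affine t (- s)) X2 Z2"
  obtains k where "k \<noteq> 0" "X1 * X2 = k * ((t * X + \<alpha> * Z) ^ 2 + 4 * \<beta> * Z * (X + t * Z))"
    "X1 * Z2 + X2 * Z1 = k * (2 * ((X + t * Z) * (t * X - \<alpha> * Z) - 2 * \<beta> * Z ^ 2))"
    "Z1 * Z2 = k * (X - t * Z) ^ 2"
proof -
  define G where "G = 4 * (t ^ 3 - \<alpha> * t - \<beta>)"
  define H where "H = (t ^ 2 + \<alpha>) ^ 2 + 8 * \<beta> * t"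
  have "G = 4 * s ^ 2" using Q by (simp add: G_def)
  then have G: "G \<noteq> 0" using s four_neq_0 by simp
  have dbl: "X' * G = H * Z'"
    if X': "abscissa (Affine t s' +\<^sub>E Affine t s') X' Z'" and s': "s' = s \<or> s' = - s" for s' X' Z'
  proof -
    have 1: "on (Affine t s')" "s' \<noteq> 0" using Q s s' by auto
    then obtain u v where "Affine t s' +\<^sub>E Affine t s' = Affine u v" by (simp add: add_tangent)
    with tangent_abscissa[OF 1 this] X' show ?thesis
      by (auto simp: abscissa_def G_def H_def algebra_simps)
  qed
  have Z: "Z \<noteq> 0" "X = t * Z" if "P = Affine t y" for y using X that by (auto simp: abscissa_def)
  \<comment> \<open>For P = Q or P = -Q one of the two sums is \<open>Infinity\<close>, the third
    form vanishes, and the other two become Z^2 times the numerator \<open>H\<close> and the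
    denominator \<open>G\<close> of the duplication formula at \<open>t\<close>.\<close>
  have sq: "(t * X + \<alpha> * Z) ^ 2 + 4 * \<beta> * Z * (X + t * Z) = Z ^ 2 * H"
    "2 * ((X + t * Z) * (t * X - \<alpha> * Z) - 2 * \<beta> * Z ^ 2) = Z ^ 2 * G"
    if "X = t * Z" unfolding that G_def H_def by (simp_all add: algebra_simps power2_eq_square power3_eq_cube)
  consider "P = Infinity" | "P = Affine t s" | "P = Affine t (- s)"
    | x y where "P = Affine x y" "x \<noteq> t"
    using P Q same_abscissa by (cases P) blast+
  then show ?thesis
  proof cases
    case 1
    then have "X \<noteq> 0" "Z = 0" "Z1 \<noteq> 0" "X1 = t * Z1" "Z2 \<noteq> 0" "X2 = t * Z2"
      using X X1 X2 by (auto simp: abscissa_def)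
    then show ?thesis
      by (intro that[of "Z1 * Z2 / X ^ 2"]) (simp_all add: field_simps power2_eq_square)
  next
    case 2
    then have "Z1 \<noteq> 0" "Z2 = 0" "X2 \<noteq> 0"
      using X1 X2 s by (auto simp: abscissa_def add_tangent)
    moreover have "X1 * G = H * Z1" using dbl[of s X1 Z1] X1 2 by simp
    ultimately show ?thesis
      using Z[OF 2] G
      by (intro that[of "X2 * Z1 / (Z ^ 2 * G)"]; (subst sq[OF Z(2)[OF 2]])?) (simp_all add: field_simps)
  next
    case 3
    then have "Z2 \<noteq> 0" "Z1 = 0" "X1 \<noteq> 0"
      using X1 X2 s by (auto simp: abscissa_def add_tangent)
    moreover have "X2 * G = H * Z2" using dbl[of "- s" X2 Z2] X2 3 by simp
    ultimately show ?thesis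
      using Z[OF 3] G
      by (intro that[of "X1 * Z2 / (Z ^ 2 * G)"]; (subst sq[OF Z(2)[OF 3]])?) (simp_all add: field_simps)
  next
    case (4 x y)
    from 4 obtain u v u' v' where uv: "Affine x y +\<^sub>E Affine t s = Affine u v"
      "Affine x y +\<^sub>E Affine t (- s) = Affine u' v'" by (simp add: add_chord)
    have nz: "Z \<noteq> 0" "X = x * Z" "Z1 \<noteq> 0" "X1 = u * Z1" "Z2 \<noteq> 0" "X2 = u' * Z2"
      using X X1 X2 4 uv by (auto simp: abscissa_def)
    have "x - t \<noteq> 0" using 4 by simp
    have "on (Affine x y)" using P 4(1) by simp
    note sp = chord_sum_product[OF this Q 4(2) uv]
    have hom: "(t * X + \<alpha> * Z) ^ 2 + 4 * \<beta> * Z * (X + t * Z) = Z ^ 2 * ((x - t) ^ 2 * (u * u'))"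
      "2 * ((X + t * Z) * (t * X - \<alpha> * Z) - 2 * \<beta> * Z ^ 2) = Z ^ 2 * ((x - t) ^ 2 * (u + u'))"
      "(X - t * Z) ^ 2 = Z ^ 2 * (x - t) ^ 2"
      unfolding sp nz by (simp_all add: algebra_simps power2_eq_square)
    show ?thesis
      by (rule that[of "Z1 * Z2 / (Z ^ 2 * (x - t) ^ 2)"], unfold hom)
         (use nz \<open>x - t \<noteq> 0\<close> in \<open>simp_all add: algebra_simps\<close>)
  qed
qed

end

text \<open>Gauss's lemma: the three elements are the coefficients of (X1 + Z1 T)(X2 + Z2 T), a
  product of primitive polynomials in T.\<close>

lemma primitive_sum_product:
  fixes X1 X2 Z1 Z2 :: "'a::factorial_ring_gcd"
  assumes "coprime X1 Z1" "coprime X2 Z2"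
    and "d dvd X1 * X2" "d dvd X1 * Z2 + X2 * Z1" "d dvd Z1 * Z2"
  shows "is_unit d"
proof (rule ccontr)
  assume "\<not> is_unit d"
  moreover have "d \<noteq> 0"
  proof
    assume "d = 0"
    with assms show False by auto
  qed
  ultimately obtain q where q: "prime q" "q dvd d" using prime_divisor_exists by blast
  then have "q dvd X1 * X2" "q dvd X1 * Z2 + X2 * Z1" "q dvd Z1 * Z2"
    using assms(3-5) dvd_trans by blast+
  moreover have "\<not> (q dvd X1 \<and> q dvd Z1)" "\<not> (q dvd X2 \<and> q dvd Z2)"
    using assms(1,2) q by (meson coprime_common_divisor not_prime_unit)+
  ultimately show False
    using q by (auto simp: prime_dvd_mult_iff dvd_add_right_iff dvd_add_left_iff)
qed

text \<open>
  A common prime divisor would divide \<open>X - t Z\<close> but not \<open>Z\<close>, hence both the numerator and the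
  denominator of the duplication formula at \<open>t\<close>, whose resultant is essentially the discriminant.
\<close>

lemma primitive_duplication:
  fixes X Z t a b :: "'a::factorial_ring_gcd"
  assumes "coprime X Z" and disc: "is_unit (4 * a ^ 3 - 27 * b ^ 2)" and two: "is_unit (2::'a)"
    and "d dvd (t * X + a * Z) ^ 2 + 4 * b * Z * (X + t * Z)"
    and "d dvd 2 * ((X + t * Z) * (t * X - a * Z) - 2 * b * Z ^ 2)"
    and "d dvd (X - t * Z) ^ 2" "d \<noteq> 0"
  shows "is_unit d"
proof (rule ccontr)
  assume "\<not> is_unit d"
  with \<open>d \<noteq> 0\<close> obtain q where q: "prime q" "q dvd d" using prime_divisor_exists by blast
  then have dvd: "q dvd (t * X + a * Z) ^ 2 + 4 * b * Z * (X + t * Z)"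
    "q dvd 2 * ((X + t * Z) * (t * X - a * Z) - 2 * b * Z ^ 2)" "q dvd (X - t * Z) ^ 2"
    using assms(4-6) dvd_trans by blast+
  from dvd(3) q have "q dvd X - t * Z" using prime_dvd_power by blast
  then obtain r where "X - t * Z = q * r" by (elim dvdE)
  then have X: "X = t * Z + q * r" by (simp add: algebra_simps)
  have "\<not> q dvd Z"
  proof
    assume "q dvd Z"
    then have "q dvd X" unfolding X by simp
    with \<open>q dvd Z\<close> show False using assms(1) q by (meson coprime_common_divisor not_prime_unit)
  qed
  have "q dvd Z ^ 2 * ((t ^ 2 + a) ^ 2 + 8 * b * t)"
  proof -
    have "(t * X + a * Z) ^ 2 + 4 * b * Z * (X + t * Z) = Z ^ 2 * ((t ^ 2 + a) ^ 2 + 8 * b * t)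
        + q * (r * (2 * t * (t * (t * Z) + a * Z) + t * t * q * r + 4 * b * Z))"
      unfolding X by (simp add: algebra_simps power2_eq_square)
    with dvd(1) show ?thesis by (metis dvd_add_left_iff dvd_triv_left)
  qed
  then have g: "q dvd (t ^ 2 + a) ^ 2 + 8 * b * t"
    using q \<open>\<not> q dvd Z\<close> by (simp add: prime_dvd_mult_iff prime_dvd_power_iff)
  have "q dvd Z ^ 2 * (4 * (t ^ 3 - a * t - b))"
  proof -
    have "2 * ((X + t * Z) * (t * X - a * Z) - 2 * b * Z ^ 2) = Z ^ 2 * (4 * (t ^ 3 - a * t - b))
        + q * (r * (2 * ((t * t * Z - a * Z) + (2 * t * Z + q * r) * t)))"
      unfolding X by (simp add: algebra_simps power2_eq_square power3_eq_cube)
    with dvd(2) show ?thesis by (metis dvd_add_left_iff dvd_triv_left)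
  qed
  moreover have "\<not> q dvd 2" using two q by (meson dvd_trans not_prime_unit)
  then have "\<not> q dvd 2 * 2" using q prime_dvd_multD by blast
  then have "\<not> q dvd 4" by simp
  ultimately have f: "q dvd t ^ 3 - a * t - b"
    using q \<open>\<not> q dvd Z\<close> prime_dvd_mult_iff prime_dvd_power by metis
  \<comment> \<open>A Bezout identity between numerator and denominator of the duplication formula,
    with the discriminant as right-hand side.\<close>
  have "(3 * t ^ 2 - 4 * a) * ((t ^ 2 + a) ^ 2 + 8 * b * t) - (3 * t ^ 3 + 5 * a * t + 27 * b) * (t ^ 3 - a * t - b)
      = - (4 * a ^ 3 - 27 * b ^ 2)"
    by (simp add: algebra_simps power2_eq_square power3_eq_cube)
  moreover have "q dvd (3 * t ^ 2 - 4 * a) * ((t ^ 2 + a) ^ 2 + 8 * b * t) - (3 * t ^ 3 + 5 * a * t + 27 * b) * (t ^ 3 - a * t - b)"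
    using f g by simp
  ultimately have "q dvd 4 * a ^ 3 - 27 * b ^ 2" by (metis dvd_minus_iff)
  then show False using disc q by (meson dvd_trans not_prime_unit)
qed


section \<open>Degrees and the pole at infinity\<close>

text \<open>The rational function \<open>X / Z\<close> has a pole at infinity.\<close>

definition dominates :: "'a::zero poly \<Rightarrow> 'a poly \<Rightarrow> bool" where
  "dominates X Z \<longleftrightarrow> X \<noteq> 0 \<and> (Z = 0 \<or> degree Z < degree X)"

lemma degree_times_le:
  fixes p q :: "'a::comm_semiring_0 poly"
  assumes "degree p \<le> m" "degree q \<le> n"
  shows "degree (p * q) \<le> m + n"
  using degree_mult_le[of p q] assms by linarith

text \<open>The pole gives deg (t Z) \<le> deg X, so that (t X)^2 is the only term of degree 2 deg X
  + 2 in the product form, and the other two forms stay below it.\<close>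

lemma degree_duplication:
  fixes X Z a b :: "'a::field poly"
  assumes dom: "dominates X Z" and a: "degree a = 0" and b: "degree b = 0"
  defines "t \<equiv> [:0, 1:]"
  shows "degree ((t * X + a * Z) ^ 2 + 4 * b * Z * (X + t * Z)) = 2 * degree X + 2"
    and "degree (2 * ((X + t * Z) * (t * X - a * Z) - 2 * b * Z ^ 2)) \<le> 2 * degree X + 1"
    and "degree ((X - t * Z) ^ 2) \<le> 2 * degree X"
proof -
  have X: "X \<noteq> 0" and Z: "degree Z \<le> degree X" "degree (t * Z) \<le> degree X"
    using dom by (auto simp: dominates_def t_def)
  have tX: "degree (t * X) = degree X + 1" using X by (simp add: t_def)
  have aZ: "degree (a * Z) \<le> degree X" "degree (b * Z) \<le> degree X"
    using degree_mult_le[of a Z] degree_mult_le[of b Z] a b Z by simp_all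
  have const: "degree (numeral n * p) \<le> degree p" for n and p :: "'a poly"
    using degree_mult_le[of "numeral n" p] by simp
  have XtZ: "degree (X + t * Z) \<le> degree X" "degree (X - t * Z) \<le> degree X"
    using Z by (auto intro: degree_add_le degree_diff_le)
  have "degree (t * X + a * Z) = degree X + 1"
    using aZ tX by (subst degree_add_eq_left) simp_all
  then have 1: "degree ((t * X + a * Z) ^ 2) = 2 * degree X + 2"
    by (subst degree_power_eq) auto
  have "degree (4 * (b * Z) * (X + t * Z)) \<le> degree X + degree X"
    by (intro degree_times_le order_trans[OF const aZ(2)] XtZ)
  then show "degree ((t * X + a * Z) ^ 2 + 4 * b * Z * (X + t * Z)) = 2 * degree X + 2"
    using 1 by (subst degree_add_eq_left) (simp_all add: mult.assoc)
  have "degree (t * X - a * Z) \<le> degree X + 1"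
    using aZ tX by (intro degree_diff_le) simp_all
  then have "degree ((X + t * Z) * (t * X - a * Z)) \<le> degree X + (degree X + 1)"
    by (intro degree_times_le XtZ)
  moreover have "degree (2 * b * Z ^ 2) \<le> degree X + degree X"
    unfolding mult.assoc[of 2] power2_eq_square
    using order_trans[OF const degree_times_le[OF aZ(2) Z(1)], of _] by (simp add: mult.assoc)
  ultimately show "degree (2 * ((X + t * Z) * (t * X - a * Z) - 2 * b * Z ^ 2)) \<le> 2 * degree X + 1"
    by (intro order_trans[OF const] degree_diff_le) simp_all
  show "degree ((X - t * Z) ^ 2) \<le> 2 * degree X"
    using degree_times_le[OF XtZ(2) XtZ(2)] by (simp add: power2_eq_square)
qed

text \<open>X1 / Z1 is a root of W T^2 - V T + U. The degree bounds fall by one from U to V and from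
  V to W, so at a root without a pole nothing could cancel the leading term of U.\<close>

lemma dominates_of_sum_product:
  fixes X1 Z1 X2 Z2 U V W :: "'a::field poly"
  assumes U: "degree U = 2 * d + 2" "degree V \<le> 2 * d + 1" "degree W \<le> 2 * d"
    and c: "c \<noteq> 0" "X1 * X2 = smult c U" "X1 * Z2 + X2 * Z1 = smult c V" "Z1 * Z2 = smult c W"
  shows "dominates X1 Z1"
proof (rule ccontr)
  assume neg: "\<not> dominates X1 Z1"
  have "U \<noteq> 0" using U by auto
  then have X1: "X1 \<noteq> 0" using c by auto
  with neg have Z1: "Z1 \<noteq> 0" "degree X1 \<le> degree Z1" by (auto simp: dominates_def)
  have "(X1 * X2) * Z1 ^ 2 = (X1 * Z2 + X2 * Z1) * (X1 * Z1) - (Z1 * Z2) * X1 ^ 2"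
    by (simp add: algebra_simps power2_eq_square)
  then have "smult c (U * Z1 ^ 2) = smult c (V * (X1 * Z1) - W * X1 ^ 2)"
    unfolding c by (simp add: smult_diff_right)
  then have "smult c (U * Z1 ^ 2 - (V * (X1 * Z1) - W * X1 ^ 2)) = 0"
    by (subst smult_diff_right) simp
  then have eq: "U * Z1 ^ 2 = V * (X1 * Z1) - W * X1 ^ 2" using c(1) by simp
  have "degree (V * (X1 * Z1)) \<le> (2 * d + 1) + (degree Z1 + degree Z1)"
    "degree (W * (X1 * X1)) \<le> 2 * d + (degree Z1 + degree Z1)"
    using U Z1 by (intro degree_times_le; simp)+
  then have "degree (U * Z1 ^ 2) \<le> 2 * d + 1 + 2 * degree Z1"
    unfolding eq by (intro degree_diff_le) (simp_all add: power2_eq_square)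
  moreover have "degree (U * Z1 ^ 2) = 2 * d + 2 + 2 * degree Z1"
    using \<open>U \<noteq> 0\<close> Z1 U by (simp add: degree_mult_eq degree_power_eq)
  ultimately show False by simp
qed


section \<open>The twist over the function field\<close>

locale function_field_twist = elliptic_curve \<alpha> \<beta> for \<alpha> \<beta> :: "'a::field_gcd"
begin

definition cubic :: "'a poly" where "cubic = [:- \<beta>, - \<alpha>, 0, 1:]"

abbreviation var :: "'a poly" where "var \<equiv> [:0, 1:]"

text \<open>
  With \<open>f\<close> for \<open>cubic\<close>, the twisted curve \<open>f(t) y\<^sup>2 = f(x)\<close> over the field of rational functions
  in \<open>t\<close> is brought into Weierstrass form by \<open>(x, y) \<mapsto> (f(t) x, f(t)\<^sup>2 y)\<close>; the generic point
  is the image of \<open>(t, 1)\<close>.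
\<close>

definition twist\<alpha> :: "'a poly fract" where "twist\<alpha> = to_fract [:\<alpha>:] * to_fract cubic ^ 2"
definition twist\<beta> :: "'a poly fract" where "twist\<beta> = to_fract [:\<beta>:] * to_fract cubic ^ 3"

definition generic_point :: "'a poly fract ell_point" where
  "generic_point = Affine (to_fract cubic * to_fract var) (to_fract cubic ^ 2)"

lemma cubic_eq: "cubic = var ^ 3 - [:\<alpha>:] * var - [:\<beta>:]"
  by (simp add: cubic_def power3_eq_cube)

lemma cubic_neq_0: "cubic \<noteq> 0"
  by (simp add: cubic_def)

lemma to_fract_cubic_neq_0: "to_fract cubic \<noteq> 0"
  using cubic_neq_0 by simp

lemma to_fract_power: "to_fract (x ^ n) = to_fract x ^ n" for x :: "'a poly"
  by (induction n) simp_all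

lemma to_fract_numeral: "to_fract (numeral n) = numeral n"
proof -
  have "to_fract (of_nat m) = of_nat m" for m
    by (induction m) simp_all
  from this[of "numeral n"] show ?thesis by simp
qed

lemma numeral_poly_const: "numeral n = [:numeral n::'a:]"
  by (simp add: numeral_poly)

lemma discriminant_unit: "is_unit (4 * [:\<alpha>:] ^ 3 - 27 * [:\<beta>:] ^ 2)"
proof -
  have "4 * [:\<alpha>:] ^ 3 - 27 * [:\<beta>:] ^ 2 = [:4 * \<alpha> ^ 3 - 27 * \<beta> ^ 2:]"
    by (simp add: numeral_poly_const poly_const_pow)
  then show ?thesis
    using nonsingular by (simp add: nonsingular_def is_unit_const_poly_iff dvd_field_iff)
qed

lemma two_unit: "is_unit (2 :: 'a poly)"
  using two_neq_0 by (simp add: numeral_poly_const is_unit_const_poly_iff dvd_field_iff)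

lemma elliptic_curve_twist: "elliptic_curve twist\<alpha> twist\<beta>"
proof
  have "to_fract (2 :: 'a poly) \<noteq> 0" using two_unit by auto
  then show "(2 :: 'a poly fract) \<noteq> 0" by (simp only: to_fract_numeral not_False_eq_True)
  have "4 * twist\<alpha> ^ 3 - 27 * twist\<beta> ^ 2 = to_fract ((4 * [:\<alpha>:] ^ 3 - 27 * [:\<beta>:] ^ 2) * cubic ^ 6)"
    unfolding twist\<alpha>_def twist\<beta>_def
    by (simp only: to_fract_mult to_fract_diff to_fract_power to_fract_numeral)
       (simp add: algebra_simps flip: power_mult power_add)
  also have "\<dots> \<noteq> 0"
    using discriminant_unit cubic_neq_0 by (metis to_fract_eq_0_iff no_zero_divisors not_is_unit_0 power_not_zero)
  finally show "nonsingular twist\<alpha> twist\<beta>" by (simp add: nonsingular_def)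
qed

lemma on_generic_point: "on_curve twist\<alpha> twist\<beta> generic_point"
proof -
  have "to_fract cubic = to_fract var ^ 3 - to_fract [:\<alpha>:] * to_fract var - to_fract [:\<beta>:]"
    by (subst cubic_eq) (simp only: to_fract_mult to_fract_diff to_fract_power)
  then have "to_fract cubic * to_fract cubic ^ 3 = (to_fract var ^ 3 - to_fract [:\<alpha>:] * to_fract var - to_fract [:\<beta>:]) * to_fract cubic ^ 3"
    by simp
  then show ?thesis
    unfolding generic_point_def on_curve.simps twist\<alpha>_def twist\<beta>_def
    by (simp add: algebra_simps eval_nat_numeral)
qed

text \<open>X / Z is the abscissa on f(t) y^2 = f(x), before the scaling by f(t). For
  \<open>Infinity\<close>, Z = 0 and coprimality makes X a unit, hence of degree 0.\<close>

definition reduced_abscissa :: "'a poly fract ell_point \<Rightarrow> 'a poly \<Rightarrow> 'a poly \<Rightarrow> bool" where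
  "reduced_abscissa P X Z \<longleftrightarrow> coprime X Z \<and> abscissa P (to_fract cubic * to_fract X) (to_fract Z)"

lemma reduced_abscissa_exists: "\<exists>X Z. reduced_abscissa P X Z"
proof (cases P)
  case Infinity
  then have "reduced_abscissa P 1 0"
    using cubic_neq_0 by (simp add: reduced_abscissa_def abscissa_def)
  then show ?thesis by blast
next
  case (Affine x y)
  obtain X Z where q: "quot_of_fract (x / to_fract cubic) = (X, Z)" by (cases "quot_of_fract (x / to_fract cubic)")
  have "coprime X Z" "Z \<noteq> 0" "x / to_fract cubic = to_fract X / to_fract Z"
    using coprime_quot_of_fract[of "x / to_fract cubic"] snd_quot_of_fract_nonzero[of "x / to_fract cubic"]
      Fract_quot_of_fract[of "x / to_fract cubic"]
    unfolding q by (simp_all add: Fract_conv_to_fract)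
  then have "reduced_abscissa P X Z"
    using Affine cubic_neq_0 by (simp add: reduced_abscissa_def abscissa_def field_simps)
  then show ?thesis by blast
qed

text \<open>The triple of symmetric functions of the two abscissae is a multiple \<open>K\<close> =
  c / e of the triple (U, V, W). Both triples are free of common factors, so \<open>c\<close> and
  \<open>e\<close> are units, and X1 X2 has exactly the degree of U.\<close>

lemma degree_parallelogram:
  assumes P: "on_curve twist\<alpha> twist\<beta> P" and X: "reduced_abscissa P X Z" and dom: "dominates X Z"
    and X1: "reduced_abscissa (ell_add twist\<alpha> P generic_point) X1 Z1"
    and X2: "reduced_abscissa (ell_add twist\<alpha> P (ell_neg generic_point)) X2 Z2"
  shows "degree X1 + degree X2 = 2 * degree X + 2" "dominates X1 Z1" "dominates X2 Z2"
proof -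
  define U where "U = (var * X + [:\<alpha>:] * Z) ^ 2 + 4 * [:\<beta>:] * Z * (X + var * Z)"
  define V where "V = 2 * ((X + var * Z) * (var * X - [:\<alpha>:] * Z) - 2 * [:\<beta>:] * Z ^ 2)"
  define W where "W = (X - var * Z) ^ 2"
  let ?f = "to_fract cubic"
  have f: "?f \<noteq> 0" by (rule to_fract_cubic_neq_0)
  have cop: "coprime X Z" "coprime X1 Z1" "coprime X2 Z2"
    using X X1 X2 by (simp_all add: reduced_abscissa_def)
  obtain k where k: "k \<noteq> 0"
    "(?f * to_fract X1) * (?f * to_fract X2) = k * (((?f * to_fract var) * (?f * to_fract X) + twist\<alpha> * to_fract Z) ^ 2
        + 4 * twist\<beta> * to_fract Z * (?f * to_fract X + (?f * to_fract var) * to_fract Z))"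
    "(?f * to_fract X1) * to_fract Z2 + (?f * to_fract X2) * to_fract Z1 =
      k * (2 * ((?f * to_fract X + (?f * to_fract var) * to_fract Z) * ((?f * to_fract var) * (?f * to_fract X) - twist\<alpha> * to_fract Z)
         - 2 * twist\<beta> * to_fract Z ^ 2))"
    "to_fract Z1 * to_fract Z2 = k * (?f * to_fract X - (?f * to_fract var) * to_fract Z) ^ 2"
    using elliptic_curve.abscissa_add_sub[OF elliptic_curve_twist P on_generic_point[unfolded generic_point_def],
      of "?f * to_fract X" "to_fract Z" "?f * to_fract X1" "to_fract Z1" "?f * to_fract X2" "to_fract Z2"]
      X X1 X2 f unfolding reduced_abscissa_def generic_point_def by auto
  \<comment> \<open>The scaling by f puts f^2, f, 1 on the left of the three equations and f^4, f^3,
    f^2 on the right, so the same factor k f^2 remains in each.\<close>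
  define K where "K = k * ?f ^ 2"
  have K0: "K \<noteq> 0" using k(1) f by (simp add: K_def)
  have "?f ^ 2 * to_fract (X1 * X2) = ?f ^ 2 * (K * to_fract U)"
    using k(2) unfolding U_def K_def twist\<alpha>_def twist\<beta>_def
    by (simp only: to_fract_mult to_fract_diff to_fract_add to_fract_power to_fract_numeral)
       (simp add: algebra_simps eval_nat_numeral)
  then have KU: "to_fract (X1 * X2) = K * to_fract U" using f by simp
  have "?f * to_fract (X1 * Z2 + X2 * Z1) = ?f * (K * to_fract V)"
    using k(3) unfolding V_def K_def twist\<alpha>_def twist\<beta>_def
    by (simp only: to_fract_mult to_fract_diff to_fract_add to_fract_power to_fract_numeral)
       (simp add: algebra_simps eval_nat_numeral)
  then have KV: "to_fract (X1 * Z2 + X2 * Z1) = K * to_fract V" using f by simp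
  have KW: "to_fract (Z1 * Z2) = K * to_fract W"
    using k(4) unfolding W_def K_def
    by (simp only: to_fract_mult to_fract_diff to_fract_add to_fract_power to_fract_numeral)
       (simp add: algebra_simps eval_nat_numeral)
  obtain c e where q: "quot_of_fract K = (c, e)" by (cases "quot_of_fract K")
  have ce: "coprime c e" "e \<noteq> 0" "K = to_fract c / to_fract e"
    using coprime_quot_of_fract[of K] snd_quot_of_fract_nonzero[of K] Fract_quot_of_fract[of K]
    unfolding q by (simp_all add: Fract_conv_to_fract)
  have c0: "c \<noteq> 0" using K0 ce by auto
  have clear: "e * A = c * B" if "to_fract A = K * to_fract B" for A B
  proof -
    have "to_fract (e * A) = to_fract (c * B)" using that ce by (simp add: field_simps)
    then show ?thesis by (simp only: to_fract_eq_iff)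
  qed
  note eU = clear[OF KU] and eV = clear[OF KV] and eW = clear[OF KW]
  have "c dvd e * (X1 * X2)" "c dvd e * (X1 * Z2 + X2 * Z1)" "c dvd e * (Z1 * Z2)"
    unfolding eU eV eW by simp_all
  then have "c dvd X1 * X2" "c dvd X1 * Z2 + X2 * Z1" "c dvd Z1 * Z2"
    using ce(1) by (simp_all add: coprime_dvd_mult_right_iff)
  then have cu: "is_unit c" using primitive_sum_product cop by blast
  have "e dvd c * U" "e dvd c * V" "e dvd c * W"
    unfolding eU[symmetric] eV[symmetric] eW[symmetric] by simp_all
  then have "e dvd U" "e dvd V" "e dvd W"
    using ce(1) by (simp_all add: coprime_dvd_mult_right_iff coprime_commute)
  then have eu: "is_unit e"
    using primitive_duplication[OF cop(1) discriminant_unit two_unit, of e var] ce(2)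
    unfolding U_def V_def W_def by blast
  obtain c' e' where cc: "c = [:c':]" "c' \<noteq> 0" "e = [:e':]" "e' \<noteq> 0"
    using cu eu c0 ce(2) by (metis is_unit_poly_iff pCons_eq_0_iff)
  define r where "r = c' / e'"
  have r: "A = smult r B" if "e * A = c * B" for A B
  proof -
    have "smult e' A = smult c' B" using that cc by simp
    then have "smult (1 / e') (smult e' A) = smult (1 / e') (smult c' B)" by simp
    then show ?thesis using cc by (simp add: r_def)
  qed
  have r0: "r \<noteq> 0" using cc by (simp add: r_def)
  note rUVW = r[OF eU] r[OF eV] r[OF eW]
  have deg: "degree U = 2 * degree X + 2" "degree V \<le> 2 * degree X + 1" "degree W \<le> 2 * degree X"
    using degree_duplication[OF dom, of "[:\<alpha>:]" "[:\<beta>:]"] unfolding U_def V_def W_def by simp_all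
  show d1: "dominates X1 Z1"
    using dominates_of_sum_product[OF deg r0 rUVW] .
  show d2: "dominates X2 Z2"
    using dominates_of_sum_product[OF deg r0, of X2 X1 Z1 Z2] rUVW by (simp add: mult.commute add.commute)
  have "degree (X1 * X2) = 2 * degree X + 2" unfolding rUVW(1) using r0 deg(1) by simp
  then show "degree X1 + degree X2 = 2 * degree X + 2"
    using d1 d2 by (simp add: dominates_def degree_mult_eq)
qed

text \<open>The degrees have second difference 2, so their first two values determine them as a
  quadratic polynomial, which is nonnegative as a degree. The disjunction in \<open>step\<close>
  lets one induction serve both directions, adding or subtracting the generic point.\<close>

lemma degree_sequence:
  fixes B :: "nat \<Rightarrow> 'a poly fract ell_point"
  assumes on: "\<And>n. on_curve twist\<alpha> twist\<beta> (B n)"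
    and step: "\<And>n. (B (n + 2) = ell_add twist\<alpha> (B (n + 1)) generic_point \<and> B n = ell_add twist\<alpha> (B (n + 1)) (ell_neg generic_point))
      \<or> (B n = ell_add twist\<alpha> (B (n + 1)) generic_point \<and> B (n + 2) = ell_add twist\<alpha> (B (n + 1)) (ell_neg generic_point))"
    and B0: "reduced_abscissa (B 0) X0 Z0"
    and B1: "reduced_abscissa (B 1) X1 Z1" "dominates X1 Z1"
  shows "int n ^ 2 + int n * (int (degree X1) - int (degree X0) - 1) + int (degree X0) \<ge> 0"
proof -
  define D where "D = (\<lambda>n::nat. int n ^ 2 + int n * (int (degree X1) - int (degree X0) - 1) + int (degree X0))"
  have "\<exists>X Z X' Z'. reduced_abscissa (B n) X Z \<and> reduced_abscissa (B (n + 1)) X' Z' \<and> dominates X' Z'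
    \<and> int (degree X) = D n \<and> int (degree X') = D (n + 1)" for n
  proof (induction n)
    case 0
    show ?case using B0 B1 by (intro exI[of _ X0] exI[of _ Z0] exI[of _ X1] exI[of _ Z1]) (simp add: D_def)
  next
    case (Suc n)
    then obtain X Z X' Z' where IH: "reduced_abscissa (B n) X Z" "reduced_abscissa (B (n + 1)) X' Z'"
      "dominates X' Z'" "int (degree X) = D n" "int (degree X') = D (n + 1)" by blast
    obtain X'' Z'' where *: "reduced_abscissa (B (n + 2)) X'' Z''" using reduced_abscissa_exists by blast
    have "degree X + degree X'' = 2 * degree X' + 2 \<and> dominates X'' Z''"
      using step[of n]
    proof
      assume "B (n + 2) = ell_add twist\<alpha> (B (n + 1)) generic_point \<and> B n = ell_add twist\<alpha> (B (n + 1)) (ell_neg generic_point)"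
      then show ?thesis
        using degree_parallelogram[OF on IH(2,3), of X'' Z'' X Z] IH(1) * by simp
    next
      assume "B n = ell_add twist\<alpha> (B (n + 1)) generic_point \<and> B (n + 2) = ell_add twist\<alpha> (B (n + 1)) (ell_neg generic_point)"
      then show ?thesis
        using degree_parallelogram[OF on IH(2,3), of X Z X'' Z''] IH(1) * by simp
    qed
    moreover from this have "int (degree X'') = 2 * D (n + 1) + 2 - D n" using IH by linarith
    moreover have "2 * D (n + 1) + 2 - D n = D (n + 2)"
      by (simp add: D_def algebra_simps power2_eq_square)
    ultimately show ?case
      using IH * by (intro exI[of _ X'] exI[of _ Z'] exI[of _ X''] exI[of _ Z'']) simp
  qed
  then have "D n \<ge> 0" by (metis of_nat_0_le_iff)
  then show ?thesis by (simp add: D_def)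
qed

lemma iterate_add_point:
  assumes P: "on_curve twist\<alpha> twist\<beta> P" and Q: "on_curve twist\<alpha> twist\<beta> Q"
  defines "B \<equiv> (\<lambda>n. ((\<lambda>R. ell_add twist\<alpha> R Q) ^^ n) P)"
  shows "on_curve twist\<alpha> twist\<beta> (B n)" "B (n + 2) = ell_add twist\<alpha> (B (n + 1)) Q"
    "B n = ell_add twist\<alpha> (B (n + 1)) (ell_neg Q)"
proof -
  interpret tw: elliptic_curve twist\<alpha> twist\<beta> by (rule elliptic_curve_twist)
  show on: "on_curve twist\<alpha> twist\<beta> (B n)" for n
    by (induction n) (simp_all add: B_def P Q tw.add_closed)
  show "B (n + 2) = ell_add twist\<alpha> (B (n + 1)) Q" by (simp add: B_def)
  show "B n = ell_add twist\<alpha> (B (n + 1)) (ell_neg Q)"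
    using tw.add_neg_cancel[OF on[of n] Q] by (simp add: B_def)
qed

text \<open>
  The quadratic polynomial is the degree of the abscissa of \<open>P - n Q\<close>, \<open>Q\<close> being the generic point.
\<close>

lemma degree_quadratic_nonneg:
  assumes P: "on_curve twist\<alpha> twist\<beta> P" and X: "reduced_abscissa P X Z" "dominates X Z"
    and X1: "reduced_abscissa (ell_add twist\<alpha> P (ell_neg generic_point)) X1 Z1"
  defines "a \<equiv> int (degree X) + 1 - int (degree X1)"
  shows "n ^ 2 - n * a + int (degree X) \<ge> 0"
proof (cases "n \<ge> 0")
  interpret tw: elliptic_curve twist\<alpha> twist\<beta> by (rule elliptic_curve_twist)
  note Q = on_generic_point
  have negQ: "on_curve twist\<alpha> twist\<beta> (ell_neg generic_point)" using Q by simp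
  obtain X2 Z2 where X2: "reduced_abscissa (ell_add twist\<alpha> P generic_point) X2 Z2"
    using reduced_abscissa_exists by blast
  note par = degree_parallelogram[OF P X X2 X1]
  {
    case True
    then obtain m where m: "n = int m" by (metis nonneg_int_cases)
    note it = iterate_add_point[OF P negQ, unfolded ell_neg_neg]
    have "0 \<le> int m ^ 2 + int m * (int (degree X1) - int (degree X) - 1) + int (degree X)"
      by (rule degree_sequence[OF it(1) disjI2[OF conjI[OF it(3) it(2)]], of X Z X1 Z1 m]) (use X X1 par in simp_all)
    then show ?thesis by (simp add: m a_def algebra_simps)
  next
    case False
    define m where "m = nat (- n)"
    have m: "n = - int m" using False by (simp add: m_def)
    note it = iterate_add_point[OF P Q]
    have "0 \<le> int m ^ 2 + int m * (int (degree X2) - int (degree X) - 1) + int (degree X)"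
      by (rule degree_sequence[OF it(1) disjI1[OF conjI[OF it(2) it(3)]], of X Z X2 Z2 m]) (use X X2 par in simp_all)
    moreover have "int (degree X2) = 2 * int (degree X) + 2 - int (degree X1)" using par(1) by linarith
    ultimately show ?thesis by (simp add: m a_def algebra_simps)
  }
qed

end

text \<open>The vertex a / 2 is an admissible argument only for even a. For odd a the nearest
  integer gives just a^2 \<le> 4 p + 1, and equality is excluded because k (k + 1) is even while p
  is odd.\<close>

lemma discriminant_le_of_nonneg:
  fixes a :: int
  assumes p: "prime p" "odd p" and nonneg: "\<And>n. n ^ 2 - n * a + int p \<ge> 0"
  shows "a ^ 2 \<le> 4 * int p"
proof (cases "even a")
  case True
  then obtain k where k: "a = 2 * k" by (elim evenE)
  show ?thesis using nonneg[of k] by (simp add: k power2_eq_square algebra_simps)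
next
  case False
  then obtain k where k: "a = 2 * k + 1" by (elim oddE)
  have "k * (k + 1) \<le> int p" using nonneg[of k] by (simp add: k power2_eq_square algebra_simps)
  moreover have "k * (k + 1) \<noteq> int p"
  proof
    assume "k * (k + 1) = int p"
    moreover have "even (k * (k + 1))" by simp
    ultimately show False using p by simp
  qed
  ultimately show ?thesis by (simp add: k power2_eq_square algebra_simps)
qed


section \<open>The Hasse bound\<close>

lemma prod_linear_dvd:
  fixes q :: "'a::idom poly"
  assumes "finite A" "\<And>c. c \<in> A \<Longrightarrow> poly q c = 0"
  shows "(\<Prod>c\<in>A. [:- c, 1:]) dvd q"
  using assms
proof (induction A arbitrary: q rule: finite_induct)
  case (insert c A)
  then have "[:- c, 1:] dvd q" by (simp add: poly_eq_0_iff_dvd)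
  then obtain r where r: "q = [:- c, 1:] * r" by (elim dvdE)
  have "poly r d = 0" if "d \<in> A" for d
  proof -
    have "poly q d = (d - c) * poly r d" by (simp add: r algebra_simps)
    moreover have "poly q d = 0" "d \<noteq> c" using that insert by auto
    ultimately show ?thesis by auto
  qed
  then have "(\<Prod>c\<in>A. [:- c, 1:]) dvd r" by (rule insert.IH)
  then show ?case using insert.hyps r by (simp add: mult_dvd_mono del: mult_pCons_left)
qed simp

lemma degree_prod_linear: "degree (\<Prod>c\<in>A. [:- c, 1:]) = card A" for A :: "'a::idom set"
  by (induction A rule: infinite_finite_induct) (simp_all add: degree_mult_eq prod_zero_iff del: mult_pCons_left)

lemma poly_prod_linear_eq_0_iff:
  fixes A :: "'a::idom set"
  assumes "finite A"
  shows "poly (\<Prod>c\<in>A. [:- c, 1:]) x = 0 \<longleftrightarrow> x \<in> A"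
  using assms by (auto simp: poly_prod)

lemma coprime_prod_linear:
  fixes q :: "'a::field_gcd poly"
  assumes "\<And>c. c \<in> A \<Longrightarrow> poly q c \<noteq> 0"
  shows "coprime q (\<Prod>c\<in>A. [:- c, 1:])"
proof (rule prod_coprime_right)
  fix c assume "c \<in> A"
  then have "\<not> [:- c, 1:] dvd q" using assms by (simp add: poly_eq_0_iff_dvd)
  moreover have "prime_elem [:- c, 1:]" by (rule prime_elem_linear_field_poly) simp
  ultimately have "coprime [:- c, 1:] q" by (intro prime_elem_imp_coprime)
  then show "coprime q [:- c, 1:]" by (simp add: coprime_commute)
qed

lemma fermat_mod_ring: "x ^ CARD('p) = (x :: 'p::prime_card mod_ring)"
  using finite_field_power_card_eq_same[of x] by simp

lemma power_card_minus_var: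
  "monom 1 CARD('p) - [:0, 1:] = (\<Prod>c\<in>(UNIV :: 'p::prime_card mod_ring set). [:- c, 1:])"
proof -
  let ?q = "monom 1 CARD('p) - [:0, 1:] :: 'p mod_ring poly"
  have p: "CARD('p) > 1" using prime_card[where 'a = 'p] prime_gt_1_nat by blast
  have "(\<Prod>c\<in>(UNIV :: 'p mod_ring set). [:- c, 1:]) dvd ?q"
    by (rule prod_linear_dvd) (simp_all add: poly_monom fermat_mod_ring)
  then obtain r where r: "?q = (\<Prod>c\<in>(UNIV :: 'p mod_ring set). [:- c, 1:]) * r" by (elim dvdE)
  have d: "degree ?q = CARD('p)"
  proof -
    have "degree (monom 1 CARD('p) + - [:0, 1 :: 'p mod_ring:]) = degree (monom (1 :: 'p mod_ring) CARD('p))"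
      by (rule degree_add_eq_left) (use p in \<open>simp add: degree_monom_eq\<close>)
    then show ?thesis by (simp only: add_uminus_conv_diff) (simp add: degree_monom_eq)
  qed
  have r0: "r \<noteq> 0" using d r p by auto
  then have "degree ?q = CARD('p) + degree r"
    unfolding r by (subst degree_mult_eq) (simp_all add: degree_prod_linear prod_zero_iff)
  then have "degree r = 0" using d by simp
  then obtain k where k: "r = [:k:]" by (elim degree_eq_zeroE)
  have "coeff ?q CARD('p) = 1" using p by (simp add: coeff_eq_0)
  then have "lead_coeff ?q = 1" using d by simp
  then have "lead_coeff r = 1" unfolding r by (simp add: lead_coeff_mult lead_coeff_prod)
  then show ?thesis using r k by (simp add: pCons_one)
qed

text \<open>Euler's criterion by counting: squaring is two-to-one on the 2 h nonzero elements, so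
  there are h nonzero squares; they are roots of v^h - 1, which has at most h roots.\<close>

lemma card_square_roots:
  fixes v :: "'p::prime_card mod_ring"
  assumes p: "CARD('p) = 2 * h + 1" and two: "(2 :: 'p mod_ring) \<noteq> 0"
  shows "card {y. y ^ 2 = v} = (if v = 0 then 1 else if v ^ h = 1 then 2 else 0)"
proof -
  let ?U = "UNIV - {0 :: 'p mod_ring}"
  let ?S = "(\<lambda>y. y ^ 2) ` ?U"
  have h: "h > 0" using prime_card[where 'a = 'p] p by (cases h) auto
  have two_roots: "card {y. y ^ 2 = v} = 2" if "v \<in> ?S" for v
  proof -
    from that obtain y where y: "y \<noteq> 0" "v = y ^ 2" by auto
    have "- y \<noteq> y" using y two by (metis add.right_inverse mult_2 mult_eq_0_iff)
    moreover have "{x. x ^ 2 = v} = {y, - y}" using y by (auto simp: power2_eq_iff)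
    ultimately show ?thesis by simp
  qed
  have "card ?U = (\<Sum>v\<in>?S. \<Sum>y\<in>{y\<in>?U. y ^ 2 = v}. 1)"
    using sum.image_gen[of ?U "\<lambda>_. 1::nat" "\<lambda>y. y ^ 2"] by simp
  also have "\<dots> = (\<Sum>v\<in>?S. 2)"
  proof (rule sum.cong)
    fix v assume v: "v \<in> ?S"
    then have "{y\<in>?U. y ^ 2 = v} = {y. y ^ 2 = v}" by auto
    then show "(\<Sum>y\<in>{y\<in>?U. y ^ 2 = v}. 1) = (2::nat)" using two_roots[OF v] by simp
  qed simp
  finally have "card ?S = h" using p by (simp add: card_Diff_subset)
  have sub: "?S \<subseteq> {v. v ^ h = 1}"
  proof
    fix v assume "v \<in> ?S"
    then obtain y :: "'p mod_ring" where y: "y \<noteq> 0" "v = y ^ 2" by auto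
    have "y * y ^ (2 * h) = y * 1" using fermat_mod_ring[of y] p by simp
    then show "v \<in> {v. v ^ h = 1}" using y by (simp add: power_mult)
  qed
  have "card {v :: 'p mod_ring. v ^ h = 1} \<le> h"
  proof -
    have "card {v. poly (monom 1 h - 1 :: 'p mod_ring poly) v = 0} \<le> degree (monom 1 h - 1 :: 'p mod_ring poly)"
    proof (rule card_poly_roots_bound)
      have "coeff (monom 1 h - 1 :: 'p mod_ring poly) h = 1" using h by simp
      then show "monom 1 h - 1 \<noteq> (0 :: 'p mod_ring poly)" by (metis coeff_0 zero_neq_one)
    qed
    also have "\<dots> \<le> h" by (intro degree_diff_le) (simp_all add: degree_monom_le)
    finally show ?thesis by (simp add: poly_monom)
  qed
  then have S: "?S = {v. v ^ h = 1}"
    using sub \<open>card ?S = h\<close> by (intro card_seteq) auto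
  show ?thesis
  proof (cases "v = 0")
    case False
    then show ?thesis using two_roots[of v] S by (auto simp: card_eq_0_iff)
  qed simp
qed

section \<open>The Frobenius point\<close>

locale prime_field_curve = function_field_twist \<alpha> \<beta> for \<alpha> \<beta> :: "'p::prime_card mod_ring" +
  fixes half :: nat
  assumes card_eq: "CARD('p) = 2 * half + 1"
begin

lemma half_pos: "half > 0"
  using card_eq prime_gt_1_nat[OF prime_card[where 'a = 'p]] by simp

abbreviation frob_var :: "'p mod_ring poly" where "frob_var \<equiv> monom 1 CARD('p)"

lemma frob_var_eq: "frob_var = var ^ CARD('p)"
  by (simp add: monom_altdef)

text \<open>f(t)^p = f(t^p), as Frobenius is additive and fixes the coefficients. This is the
  equation that puts \<open>frob_point\<close> on the twist.\<close>

lemma cubic_power_card: "cubic ^ CARD('p) = frob_var ^ 3 - [:\<alpha>:] * frob_var - [:\<beta>:]"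
proof -
  have pr: "prime CHAR('p mod_ring poly)" "CARD('p) = CHAR('p mod_ring poly)"
    using prime_card[where 'a = 'p] by simp_all
  have "cubic = var ^ 3 + ([:- \<alpha>:] * var + [:- \<beta>:])" by (simp add: cubic_eq)
  also have "\<dots> ^ CARD('p) = (var ^ 3) ^ CARD('p) + (([:- \<alpha>:] * var) ^ CARD('p) + [:- \<beta>:] ^ CARD('p))"
    by (simp only: freshmans_dream[OF pr])
  also have "\<dots> = frob_var ^ 3 + ([:(- \<alpha>) ^ CARD('p):] * frob_var + [:(- \<beta>) ^ CARD('p):])"
    by (simp only: frob_var_eq power_mult_distrib poly_const_pow) (simp only: power_mult[symmetric] mult.commute)
  also have "\<dots> = frob_var ^ 3 - [:\<alpha>:] * frob_var - [:\<beta>:]"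
    unfolding fermat_mod_ring by simp
  finally show ?thesis .
qed

text \<open>The image of the point \<open>(t\<^sup>p, f(t)\<^bsup>(p-1)/2\<^esup>)\<close> of \<open>f(t) y\<^sup>2 = f(x)\<close>.\<close>

definition frob_point :: "'p mod_ring poly fract ell_point" where
  "frob_point = Affine (to_fract cubic * to_fract frob_var) (to_fract cubic ^ (half + 2))"

lemma on_frob_point: "on_curve twist\<alpha> twist\<beta> frob_point"
proof -
  have "to_fract (cubic ^ CARD('p)) = to_fract frob_var ^ 3 - to_fract [:\<alpha>:] * to_fract frob_var - to_fract [:\<beta>:]"
    by (subst cubic_power_card) (simp only: to_fract_mult to_fract_diff to_fract_power)
  then have "to_fract cubic ^ CARD('p) * to_fract cubic ^ 3 =
     (to_fract frob_var ^ 3 - to_fract [:\<alpha>:] * to_fract frob_var - to_fract [:\<beta>:]) * to_fract cubic ^ 3"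
    by (simp add: to_fract_power)
  moreover have "(to_fract cubic ^ (half + 2)) ^ 2 = to_fract cubic ^ CARD('p) * to_fract cubic ^ 3"
  proof -
    have "(half + 2) * 2 = CARD('p) + 3" using card_eq by simp
    then show ?thesis by (simp only: flip: power_mult power_add)
  qed
  ultimately have "(to_fract cubic ^ (half + 2)) ^ 2 =
     (to_fract frob_var ^ 3 - to_fract [:\<alpha>:] * to_fract frob_var - to_fract [:\<beta>:]) * to_fract cubic ^ 3"
    by simp
  then show ?thesis
    unfolding frob_point_def on_curve.simps twist\<alpha>_def twist\<beta>_def
    by (simp only: power2_eq_square power3_eq_cube) (simp only: algebra_simps)
qed

lemma reduced_abscissa_frob_point: "reduced_abscissa frob_point frob_var 1" "dominates frob_var 1"
proof -
  have "CARD('p) > 0" by simp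
  then show "dominates frob_var 1" by (simp add: dominates_def degree_monom_eq)
  show "reduced_abscissa frob_point frob_var 1"
    by (simp add: reduced_abscissa_def abscissa_def frob_point_def)
qed

section \<open>The point count as the degree of an abscissa\<close>

definition roots where "roots = {c. poly cubic c = 0}"
definition residues where "residues = {c. poly cubic c ^ half = 1}"
definition nonresidues where "nonresidues = {c. poly cubic c ^ half = - 1}"

lemma root_classes:
  "roots \<union> residues \<union> nonresidues = UNIV" "roots \<inter> residues = {}" "roots \<inter> nonresidues = {}"
  "residues \<inter> nonresidues = {}"
proof -
  have "v = 0 \<or> v ^ half = 1 \<or> v ^ half = - 1" for v :: "'p mod_ring"
  proof -
    have "v * (v ^ half) ^ 2 = v ^ (2 * half + 1)" by (simp add: mult.commute flip: power_mult)
    also have "\<dots> = v" by (simp only: fermat_mod_ring flip: card_eq)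
    finally have "v * (v ^ half) ^ 2 = v" .
    then have "v = 0 \<or> (v ^ half) ^ 2 = 1" by (metis mult_cancel_left2)
    then show ?thesis by (simp add: power2_eq_1_iff)
  qed
  then show "roots \<union> residues \<union> nonresidues = UNIV" by (auto simp: roots_def residues_def nonresidues_def)
  show "roots \<inter> residues = {}" "roots \<inter> nonresidues = {}"
    using half_pos by (auto simp: roots_def residues_def nonresidues_def power_0_left)
  have "(1 :: 'p mod_ring) \<noteq> - 1" using uminus_eq_self_iff(2)[of 1] by simp
  then show "residues \<inter> nonresidues = {}" by (auto simp: residues_def nonresidues_def)
qed

lemma card_classes: "card roots + card residues + card nonresidues = CARD('p)"
proof -
  have "card (roots \<union> residues \<union> nonresidues) = card roots + card residues + card nonresidues"
    using root_classes by (subst card_Un_disjoint; (subst card_Un_disjoint)?) auto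
  then show ?thesis by (simp add: root_classes(1))
qed

lemma card_ell_group: "card (carrier (ell_group \<alpha> \<beta>)) = 1 + card roots + 2 * card residues"
proof -
  let ?A = "SIGMA x:(UNIV :: 'p mod_ring set). {y. y ^ 2 = poly cubic x}"
  have f: "poly cubic x = x ^ 3 - \<alpha> * x - \<beta>" for x
    by (simp add: cubic_eq)
  have "carrier (ell_group \<alpha> \<beta>) = insert Infinity ((\<lambda>(x, y). Affine x y) ` ?A)"
    unfolding ell_group_def by (auto simp: f image_iff elim: on_curve.elims)
  moreover have "Infinity \<notin> (\<lambda>(x, y). Affine x y) ` ?A" by auto
  moreover have "finite ?A" by simp
  ultimately have "card (carrier (ell_group \<alpha> \<beta>)) = 1 + card ((\<lambda>(x, y). Affine x y) ` ?A)" by simp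
  also have "card ((\<lambda>(x, y). Affine x y) ` ?A) = card ?A"
    by (intro card_image) (auto simp: inj_on_def)
  also have "\<dots> = (\<Sum>x\<in>UNIV. card {y. y ^ 2 = poly cubic x})" by (simp add: card_SigmaI)
  also have "\<dots> = (\<Sum>x\<in>UNIV. (if x \<in> roots then 1 else 0) + 2 * (if x \<in> residues then 1 else 0))"
    using root_classes(2) by (intro sum.cong)
      (auto simp: card_square_roots[OF card_eq two_neq_0] roots_def residues_def)
  also have "\<dots> = card roots + 2 * card residues"
    by (simp add: sum.distrib flip: sum_distrib_left sum.inter_filter)
  finally show ?thesis by simp
qed

text \<open>The expression is the numerator of the abscissa of Frobenius minus the generic point
  over (t^p - t)^2, up to the scaling by f. Its terms t^(3 p) cancel by f^p = f(t^p), which leaves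
  t^(2 p) t in front.\<close>

lemma degree_numerator:
  "degree (cubic * (1 + cubic ^ half) ^ 2 - (frob_var + var) * (frob_var - var) ^ 2) = 2 * CARD('p) + 1"
proof -
  have c: "degree cubic = 3" by (simp add: cubic_def)
  define R where "R = cubic + 2 * (cubic * cubic ^ half) - [:\<alpha>:] * frob_var - [:\<beta>:] + var ^ 2 * frob_var - var ^ 3"
  have expand: "c * (1 + g) ^ 2 - (F + v) * (F - v) ^ 2 = F ^ 2 * v + (c + 2 * (c * g) - A * F - B + v ^ 2 * F - v ^ 3)"
    if "c * g ^ 2 = F ^ 3 - A * F - B" for c g F v A B :: "'p mod_ring poly"
  proof -
    have "c * (1 + g) ^ 2 = c + 2 * (c * g) + c * g ^ 2" by (simp add: power2_eq_square algebra_simps)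
    then show ?thesis unfolding that by (simp add: power2_eq_square power3_eq_cube algebra_simps)
  qed
  have "cubic * (cubic ^ half) ^ 2 = cubic ^ (2 * half + 1)" by (simp add: mult.commute flip: power_mult)
  also have "\<dots> = frob_var ^ 3 - [:\<alpha>:] * frob_var - [:\<beta>:]" by (simp only: cubic_power_card flip: card_eq)
  finally have eq: "cubic * (1 + cubic ^ half) ^ 2 - (frob_var + var) * (frob_var - var) ^ 2 = frob_var ^ 2 * var + R"
    unfolding R_def by (rule expand)
  have "frob_var ^ 2 * var = var ^ (CARD('p) * 2 + 1)"
    by (simp only: frob_var_eq power_add power_mult power_one_right)
  also have "\<dots> = monom 1 (2 * CARD('p) + 1)" by (simp add: monom_altdef mult.commute)
  finally have d: "degree (frob_var ^ 2 * var) = 2 * CARD('p) + 1" by (simp add: degree_monom_eq)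
  have "degree R \<le> 2 * CARD('p)"
    unfolding R_def
  proof (intro degree_add_le degree_diff_le)
    \<comment> \<open>With p = 2 half + 1, the bound 3 + 3 half \<le> 2 p amounts to half \<ge>
      1.\<close>
    have "degree (2 * (cubic * cubic ^ half)) \<le> 0 + (3 + 3 * half)"
      by (intro degree_times_le order_trans[OF degree_power_le]) (simp_all add: c)
    then show "degree (2 * (cubic * cubic ^ half)) \<le> 2 * CARD('p)" using half_pos card_eq by linarith
    have "degree (var ^ 2 * frob_var) \<le> 2 + CARD('p)"
      by (intro degree_times_le order_trans[OF degree_power_le]) (simp_all add: degree_monom_le)
    then show "degree (var ^ 2 * frob_var) \<le> 2 * CARD('p)" using half_pos card_eq by linarith
    have "degree (var ^ 3) \<le> 3" by (rule order_trans[OF degree_power_le]) simp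
    then show "degree (var ^ 3) \<le> 2 * CARD('p)" using half_pos card_eq by linarith
  qed (use half_pos card_eq c in \<open>simp_all add: degree_monom_eq order_trans[OF degree_smult_le]\<close>)
  then show ?thesis unfolding eq using d by (subst degree_add_eq_left) simp_all
qed

text \<open>
  With denominators \<open>(t\<^sup>p - t)\<^sup>2\<close>, the abscissa has a numerator of degree \<open>2 p + 1\<close>; a linear
  factor \<open>t - c\<close> cancels once if \<open>c\<close> is a root of \<open>f\<close>, twice if \<open>f(c)\<close> is a nonresidue, and
  not at all otherwise.
\<close>

lemma reduced_abscissa_frob_point_minus:
  "\<exists>X Z. reduced_abscissa (ell_add twist\<alpha> frob_point (ell_neg generic_point)) X Z
     \<and> degree X = card (carrier (ell_group \<alpha> \<beta>))"
proof -
  define R where "R = (\<Prod>c\<in>roots. [:- c, 1:])"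
  define L where "L = (\<Prod>c\<in>residues. [:- c, 1:])"
  define S where "S = (\<Prod>c\<in>nonresidues. [:- c, 1:])"
  let ?V = "frob_var - var"
  have V: "?V = R * S * L"
  proof -
    have "(\<Prod>c\<in>roots \<union> residues \<union> nonresidues. [:- c, 1:]) = R * L * S"
      unfolding R_def L_def S_def using root_classes
      by (subst prod.union_disjoint; (subst prod.union_disjoint)?) auto
    then show ?thesis unfolding root_classes(1) power_card_minus_var by (simp add: mult_ac)
  qed
  have nz: "R \<noteq> 0" "S \<noteq> 0" "L \<noteq> 0" by (simp_all add: R_def S_def L_def prod_zero_iff)
  have poly0: "poly R c = 0 \<longleftrightarrow> c \<in> roots" "poly S c = 0 \<longleftrightarrow> c \<in> nonresidues" "poly L c = 0 \<longleftrightarrow> c \<in> residues" for c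
    unfolding R_def S_def L_def by (intro poly_prod_linear_eq_0_iff; simp)+
  have "R dvd cubic" unfolding R_def by (rule prod_linear_dvd) (simp_all add: roots_def)
  then obtain f1 where f1: "cubic = R * f1" by (elim dvdE)
  have "S dvd 1 + cubic ^ half" unfolding S_def by (rule prod_linear_dvd) (simp_all add: nonresidues_def)
  then obtain s1 where s1: "1 + cubic ^ half = S * s1" by (elim dvdE)
  \<comment> \<open>\<open>M\<close> is what remains of the numerator after division by R S^2; the
    denominator (R S L)^2 becomes R L^2, so coprimality has to be checked at roots and
    residues.\<close>
  define M where "M = f1 * s1 ^ 2 - (frob_var + var) * R * L ^ 2"
  have M: "R * S ^ 2 * M = cubic * (1 + cubic ^ half) ^ 2 - (frob_var + var) * ?V ^ 2"
    unfolding V s1 unfolding f1 M_def by (simp add: power2_eq_square algebra_simps)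
  \<comment> \<open>At a root of f the term with factor R vanishes, 1 + f^half has the value 1, and
    \<open>f1\<close> is nonzero because the root is simple.\<close>
  have "poly M c \<noteq> 0" if c: "c \<in> roots" for c
  proof
    assume "poly M c = 0"
    moreover have "poly R c = 0" using c by (simp add: poly0)
    ultimately have "poly f1 c = 0 \<or> poly s1 c = 0" by (simp add: M_def)
    moreover have "poly s1 c \<noteq> 0"
    proof
      assume "poly s1 c = 0"
      then have "poly (1 + cubic ^ half) c = 0" unfolding s1 by simp
      then show False using c half_pos by (simp add: roots_def power_0_left)
    qed
    moreover have "poly f1 c \<noteq> 0"
    proof
      assume "poly f1 c = 0"
      then have "poly (pderiv cubic) c = 0" unfolding f1 pderiv_mult using c poly0(1)[of c] by simp
      then have "3 * c ^ 2 - \<alpha> = 0" by (simp add: cubic_def pderiv_pCons power2_eq_square algebra_simps)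
      moreover have "0 = c ^ 3 - \<alpha> * c - \<beta>" using c by (simp add: roots_def cubic_eq mult.commute)
      ultimately show False using order_two_not_critical by blast
    qed
    ultimately show False by blast
  qed
  then have "coprime M R" unfolding R_def by (rule coprime_prod_linear)
  \<comment> \<open>Since t^p - t vanishes at c, the undivided numerator has the value 4 f(c)
    there.\<close>
  moreover have "poly M c \<noteq> 0" if c: "c \<in> residues" for c
  proof
    assume "poly M c = 0"
    then have "poly (R * S ^ 2 * M) c = 0" by simp
    then have "poly (cubic * (1 + cubic ^ half) ^ 2) c = 0"
      unfolding M by (simp add: poly_monom fermat_mod_ring)
    moreover have "poly cubic c \<noteq> 0" "poly cubic c ^ half = 1" using c root_classes by (auto simp: roots_def residues_def)
    ultimately show False using two_neq_0 four_neq_0 by simp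
  qed
  then have "coprime M L" unfolding L_def by (rule coprime_prod_linear)
  ultimately have cop: "coprime M (R * L ^ 2)" by simp
  \<comment> \<open>The three classes have p elements together, so 2 p + 1 less the roots and twice
    the nonresidues is one plus the roots plus twice the residues.\<close>
  have "degree (R * S ^ 2 * M) = 2 * CARD('p) + 1" unfolding M by (rule degree_numerator)
  moreover from this have "M \<noteq> 0" by auto
  then have "degree (R * S ^ 2 * M) = card roots + 2 * card nonresidues + degree M"
    using nz by (simp add: degree_mult_eq degree_power_eq) (simp add: R_def S_def degree_prod_linear)
  ultimately have degM: "degree M = card (carrier (ell_group \<alpha> \<beta>))"
    using card_classes unfolding card_ell_group by linarith
  let ?f = "to_fract cubic" and ?T = "to_fract var" and ?T' = "to_fract frob_var"
  have f: "?f \<noteq> 0" by (rule to_fract_cubic_neq_0)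
  have V0: "?T' - ?T \<noteq> 0" using V nz by (metis no_zero_divisors to_fract_diff to_fract_eq_0_iff)
  have ne: "?f * ?T' \<noteq> ?f * ?T" using f V0 by auto
  define x where "x = ((- (?f ^ 2) - ?f ^ (half + 2)) / (?f * ?T - ?f * ?T')) ^ 2 - ?f * ?T' - ?f * ?T"
  obtain y where sum: "ell_add twist\<alpha> frob_point (ell_neg generic_point) = Affine x y"
    unfolding frob_point_def generic_point_def ell_neg.simps x_def
    using elliptic_curve.add_chord[OF elliptic_curve_twist ne] by blast
  define q where "q = ?f * (1 + ?f ^ half) / (?T' - ?T)"
  have "(- (?f ^ 2) - ?f ^ (half + 2)) / (?f * ?T - ?f * ?T') = q"
  proof -
    have "- (?f ^ 2) - ?f ^ (half + 2) = - (?f * (?f * (1 + ?f ^ half)))"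
      by (simp add: power2_eq_square algebra_simps)
    moreover have "?f * ?T - ?f * ?T' = - (?f * (?T' - ?T))" by (simp add: algebra_simps)
    ultimately show ?thesis by (simp only: q_def minus_divide_divide mult_divide_mult_cancel_left[OF f])
  qed
  then have "x = q ^ 2 - ?f * ?T' - ?f * ?T" unfolding x_def by simp
  moreover have "(q ^ 2 - ?f * a - ?f * b) * d ^ 2 = (q * d) ^ 2 - ?f * (a + b) * d ^ 2" for a b d
    by (simp add: power_mult_distrib algebra_simps)
  ultimately have "x * (?T' - ?T) ^ 2 = (q * (?T' - ?T)) ^ 2 - ?f * (?T' + ?T) * (?T' - ?T) ^ 2"
    by simp
  also have "q * (?T' - ?T) = ?f * (1 + ?f ^ half)" using V0 by (simp add: q_def)
  also have "(?f * (1 + ?f ^ half)) ^ 2 - ?f * (?T' + ?T) * (?T' - ?T) ^ 2 =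
    ?f * (?f * (1 + ?f ^ half) ^ 2 - (?T' + ?T) * (?T' - ?T) ^ 2)"
    by (simp add: power_mult_distrib power2_eq_square right_diff_distrib mult.assoc)
  finally have "x * (?T' - ?T) ^ 2 = ?f * (?f * (1 + ?f ^ half) ^ 2 - (?T' + ?T) * (?T' - ?T) ^ 2)" .
  then have "x * to_fract (?V ^ 2) = ?f * to_fract (R * S ^ 2 * M)"
    unfolding M by (simp only: to_fract_mult to_fract_diff to_fract_add to_fract_power to_fract_1)
  then have "(x * to_fract (R * L ^ 2)) * to_fract (R * S ^ 2) = (?f * to_fract M) * to_fract (R * S ^ 2)"
    unfolding V by (simp add: power_mult_distrib power2_eq_square mult_ac)
  then have "x * to_fract (R * L ^ 2) = ?f * to_fract M" using nz by simp
  then have "reduced_abscissa (ell_add twist\<alpha> frob_point (ell_neg generic_point)) M (R * L ^ 2)"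
    unfolding sum reduced_abscissa_def abscissa_def using cop nz by simp
  then show ?thesis using degM by blast
qed

theorem hasse_bound: "frob_trace \<alpha> \<beta> ^ 2 \<le> 4 * int CARD('p)"
proof -
  obtain X Z where X: "reduced_abscissa (ell_add twist\<alpha> frob_point (ell_neg generic_point)) X Z"
    "degree X = card (carrier (ell_group \<alpha> \<beta>))"
    using reduced_abscissa_frob_point_minus by blast
  have "n ^ 2 - n * frob_trace \<alpha> \<beta> + int CARD('p) \<ge> 0" for n
    using degree_quadratic_nonneg[OF on_frob_point reduced_abscissa_frob_point X(1), of n] X(2)
    by (simp add: frob_trace_def degree_monom_eq add.commute)
  then show ?thesis by (intro discriminant_le_of_nonneg prime_card) (simp_all add: card_eq)
qed

end


section \<open>Power moments\<close>

context
  includes fps_syntax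
begin

lemma fps_one_minus_X_nth_mult:
  "((1 - fps_const c * fps_X) * F) $ n = F $ n - c * (if n = 0 then 0 else F $ (n - 1))"
  for F :: "'a::comm_ring_1 fps"
  by (simp add: left_diff_distrib mult.assoc)

text \<open>The factor for b = 0 is 1 and adds no degree; this is why \<open>delta\<close> counts
  only nonzero traces.\<close>

lemma prod_one_minus_X_nth_eq_0:
  fixes B :: "'a::comm_ring_1 set"
  assumes "finite B" "card (B - {0}) < n"
  shows "(\<Prod>b\<in>B. 1 - fps_const b * fps_X) $ n = 0"
  using assms
proof (induction B arbitrary: n rule: finite_induct)
  case (insert b B)
  show ?case
  proof (cases "b = 0")
    case True then show ?thesis using insert by simp
  next
    case False
    then have c: "card (insert b B - {0}) = Suc (card (B - {0}))"
      using insert by (simp add: insert_Diff_if)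
    then have "(\<Prod>b\<in>B. 1 - fps_const b * fps_X) $ n = 0"
      "(\<Prod>b\<in>B. 1 - fps_const b * fps_X) $ (n - 1) = 0"
      using insert.prems by (intro insert.IH; simp)+
    then show ?thesis using insert.hyps by (simp add: fps_one_minus_X_nth_mult)
  qed
qed simp

lemma prod_one_minus_X_of_int:
  fixes B :: "int set"
  assumes "finite B"
  shows "(\<Prod>b\<in>B. 1 - fps_const (of_int b) * fps_X :: 'a::comm_ring_1 fps) $ n =
    of_int ((\<Prod>b\<in>B. 1 - fps_const b * fps_X) $ n)"
  using assms
proof (induction B arbitrary: n rule: finite_induct)
  case (insert b B)
  then show ?case by (simp add: fps_one_minus_X_nth_mult)
qed simp

lemma geometric_fps_mult: "Abs_fps (\<lambda>m. a ^ m) * (1 - fps_const a * fps_X) = 1"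
  for a :: "'a::comm_ring_1"
proof (rule fps_ext)
  fix n show "(Abs_fps (\<lambda>m. a ^ m) * (1 - fps_const a * fps_X)) $ n = 1 $ n"
    by (cases n) (simp_all add: mult.commute[of "Abs_fps _"] fps_one_minus_X_nth_mult)
qed

text \<open>Each geometric series cancels its own factor of the product. For \<open>f i\<close> = 0
  that factor is 1 and the degree does not drop, so the bound is \<open>card (F - {0})\<close>
  itself.\<close>

lemma power_sums_mult_prod_nth_eq_0:
  fixes f :: "'i \<Rightarrow> 'a::comm_ring_1"
  assumes F: "finite F" and f: "f ` S \<subseteq> F" and n: "n > card (F - {0})"
  shows "(Abs_fps (\<lambda>m. \<Sum>i\<in>S. f i ^ m) * (\<Prod>a\<in>F. 1 - fps_const a * fps_X)) $ n = 0"
proof -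
  have "Abs_fps (\<lambda>m. \<Sum>i\<in>S. f i ^ m) = (\<Sum>i\<in>S. Abs_fps (\<lambda>m. f i ^ m))"
    by (rule fps_ext) (simp add: fps_sum_nth)
  then have "Abs_fps (\<lambda>m. \<Sum>i\<in>S. f i ^ m) * (\<Prod>a\<in>F. 1 - fps_const a * fps_X) =
     (\<Sum>i\<in>S. Abs_fps (\<lambda>m. f i ^ m) * (\<Prod>a\<in>F. 1 - fps_const a * fps_X))"
    by (simp add: sum_distrib_right)
  also have "\<dots> = (\<Sum>i\<in>S. \<Prod>a\<in>F - {f i}. 1 - fps_const a * fps_X)"
  proof (rule sum.cong)
    fix i assume "i \<in> S"
    then have "(\<Prod>a\<in>F. 1 - fps_const a * fps_X) =
      (1 - fps_const (f i) * fps_X) * (\<Prod>a\<in>F - {f i}. 1 - fps_const a * fps_X)"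
      using F f by (intro prod.remove) auto
    then show "Abs_fps (\<lambda>m. f i ^ m) * (\<Prod>a\<in>F. 1 - fps_const a * fps_X) =
        (\<Prod>a\<in>F - {f i}. 1 - fps_const a * fps_X)"
      by (simp add: mult.assoc[symmetric] geometric_fps_mult)
  qed simp
  also have "\<dots> $ n = 0"
    unfolding fps_sum_nth
  proof (rule sum.neutral, rule ballI)
    fix i
    have "card (F - {f i} - {0}) \<le> card (F - {0})" using F by (intro card_mono) auto
    then show "(\<Prod>a\<in>F - {f i}. 1 - fps_const a * fps_X) $ n = 0"
      using F n by (intro prod_one_minus_X_nth_eq_0) auto
  qed
  finally show ?thesis .
qed

lemma fps_truncation_mult_nth:
  fixes M :: "nat \<Rightarrow> 'a::comm_ring_1"
  assumes "n \<le> d"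
  shows "((\<Sum>m\<le>d. fps_const (M m) * fps_X ^ m) * G) $ n = (Abs_fps M * G) $ n"
proof -
  have "(\<Sum>m\<le>d. fps_const (M m) * fps_X ^ m) $ i = M i" if "i \<le> d" for i
    using that by (simp add: fps_sum_nth mult_delta_right)
  then show ?thesis using assms by (simp add: fps_mult_nth)
qed

text \<open>Coefficients up to \<open>d\<close> are not affected by truncating the moments at
  \<open>d\<close>, and those beyond \<open>d\<close> vanish. The product is formed over the
  integers and then mapped to the rationals.\<close>

lemma power_sums_fps_eq:
  fixes f :: "'i \<Rightarrow> int"
  assumes F: "finite F" and f: "f ` S \<subseteq> F" and M: "\<And>m. M m = (\<Sum>i\<in>S. f i ^ m)"
    and d: "d = card (F - {0})"
  shows "Abs_fps (\<lambda>m. of_int (M m)) * (\<Prod>a\<in>F. 1 - fps_const (of_int a) * fps_X) =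
    (\<Sum>n\<le>d. fps_const (of_int (((\<Sum>m\<le>d. fps_const (M m) * fps_X ^ m)
       * (\<Prod>a\<in>F. 1 - fps_const a * fps_X)) $ n)) * fps_X ^ n :: rat fps)"
proof (rule fps_ext)
  fix n
  let ?P = "\<Prod>a\<in>F. 1 - fps_const a * fps_X :: int fps"
  have M': "M = (\<lambda>m. \<Sum>i\<in>S. f i ^ m)" using M by auto
  have "(Abs_fps (\<lambda>m. of_int (M m)) * (\<Prod>a\<in>F. 1 - fps_const (of_int a) * fps_X) :: rat fps) $ n =
     of_int ((Abs_fps M * ?P) $ n)"
    by (simp add: fps_mult_nth prod_one_minus_X_of_int[OF F])
  also have "(Abs_fps M * ?P) $ n = (if n \<le> d then ((\<Sum>m\<le>d. fps_const (M m) * fps_X ^ m) * ?P) $ n else 0)"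
    using power_sums_mult_prod_nth_eq_0[OF F f, of n] unfolding M'[symmetric]
    by (simp add: fps_truncation_mult_nth d)
  finally show "(Abs_fps (\<lambda>m. of_int (M m)) * (\<Prod>a\<in>F. 1 - fps_const (of_int a) * fps_X)) $ n =
    (\<Sum>n\<le>d. fps_const (of_int (((\<Sum>m\<le>d. fps_const (M m) * fps_X ^ m) * ?P) $ n)) * fps_X ^ n :: rat fps) $ n"
    by (simp add: fps_sum_nth mult_delta_right)
qed

end

theorem theorem1p1:
  fixes A :: "('g, 'e) monoid_scheme" and p :: nat
  assumes "comm_group A" and "finite (carrier A)"
    and "prime p" and "p \<ge> 5" and "CARD('p::prime_card) = p"
  shows "moment_series TYPE('p) A =
           moment_numer TYPE('p) A / (\<Prod>a \<in> Frob p A. 1 - fps_const (of_int a) * fps_X)"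
proof -
  let ?D = "\<Prod>a \<in> Frob p A. 1 - fps_const (of_int a) * fps_X :: rat fps"
  define S where "S = {(\<alpha> :: 'p mod_ring, \<beta>). nonsingular \<alpha> \<beta> \<and> embeds_in A (ell_group \<alpha> \<beta>)}"
  have fin: "finite (Frob p A)"
  proof (rule finite_subset)
    show "Frob p A \<subseteq> {- \<lfloor>2 * sqrt p\<rfloor>..\<lfloor>2 * sqrt p\<rfloor>}"
      by (auto simp: Frob_def le_floor_iff; linarith)
  qed simp
  have odd: "odd p" using assms(3,4) prime_odd_nat by simp
  have two: "(2 :: 'p mod_ring) \<noteq> 0"
  proof
    assume "(2 :: 'p mod_ring) = 0"
    then have "of_nat 2 = (0 :: 'p mod_ring)" by simp
    then have "CARD('p) dvd 2" by (rule of_nat_0_mod_ring_dvd)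
    then show False using assms by (auto dest: dvd_imp_le)
  qed
  have "frob_trace \<alpha> \<beta> \<in> Frob p A" if "(\<alpha>, \<beta>) \<in> S" for \<alpha> \<beta>
  proof -
    have ns: "nonsingular \<alpha> \<beta>" and emb: "embeds_in A (ell_group \<alpha> \<beta>)" using that by (auto simp: S_def)
    interpret prime_field_curve \<alpha> \<beta> "p div 2"
      using ns two odd assms(5) by unfold_locales simp_all
    have "finite (carrier (ell_group \<alpha> \<beta>))"
    proof (rule finite_subset)
      show "carrier (ell_group \<alpha> \<beta>) \<subseteq> insert Infinity (range (\<lambda>(x, y). Affine x y))"
        by (auto simp: image_iff) (metis ell_point.exhaust)
    qed simp
    then have "Coset.order A dvd Coset.order (ell_group \<alpha> \<beta>)"
      using embeds_in_dvd[OF comm_group.axioms(2)[OF assms(1)] group_ell_group _ emb] by simp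
    then have "int (Coset.order A) dvd int (card (carrier (ell_group \<alpha> \<beta>)))"
      by (simp add: Coset.order_def)
    then have "[frob_trace \<alpha> \<beta> = int p + 1] (mod int (Coset.order A))"
      using assms(5) by (simp add: frob_trace_def cong_iff_dvd_diff)
    moreover have "\<bar>real_of_int (frob_trace \<alpha> \<beta>)\<bar> \<le> 2 * sqrt p"
    proof (rule power2_le_imp_le)
      have "real_of_int ((frob_trace \<alpha> \<beta>) ^ 2) \<le> real_of_int (4 * int p)"
        using hasse_bound assms(5) by (intro of_int_le_iff[THEN iffD2]) simp
      then show "\<bar>real_of_int (frob_trace \<alpha> \<beta>)\<bar>\<^sup>2 \<le> (2 * sqrt p)\<^sup>2"
        by (simp add: power_mult_distrib)
    qed simp
    ultimately show ?thesis by (auto simp: Frob_def)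
  qed
  then have "(\<lambda>(\<alpha>, \<beta>). frob_trace \<alpha> \<beta>) ` S \<subseteq> Frob p A" by auto
  moreover have "power_moment TYPE('p) A m = (\<Sum>i\<in>S. (case i of (\<alpha>, \<beta>) \<Rightarrow> frob_trace \<alpha> \<beta>) ^ m)" for m
    unfolding power_moment_def S_def by (intro sum.cong) auto
  moreover have "delta p A = card (Frob p A - {0})"
    unfolding delta_def Frob_def by (intro arg_cong[where f = card]) auto
  ultimately have "moment_series TYPE('p) A * ?D = moment_numer TYPE('p) A"
    using power_sums_fps_eq[OF fin, of "\<lambda>(\<alpha>, \<beta>). frob_trace \<alpha> \<beta>" S "power_moment TYPE('p) A" "delta p A"]
    by (simp add: moment_series_def moment_numer_def numer_coeff_def assms(5))
  moreover have "?D \<noteq> 0"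
  proof
    assume "?D = 0"
    then obtain a where "(1 - fps_const (of_int a) * fps_X :: rat fps) = 0"
      using fin by (auto simp: prod_zero_iff)
    then have "fps_nth (1 - fps_const (of_int a) * fps_X :: rat fps) 0 = 0" by simp
    then show False by simp
  qed
  ultimately show ?thesis by (metis nonzero_mult_div_cancel_right)
qed

end
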